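(* For every $\varepsilon>0$, there are constants $\beta=\beta(\varepsilon)>0$ and $n_0=n_0(\varepsilon)\in\mathbb N$ such that the following holds. Let $d\ge 3$ be an integer, and let $G$ be a graph on $n\ge n_0$ vertices with maximum degree at most $d$. If $h(G)\ge\varepsilon d$, then $$\mathrm{ccl}(G)\ge \beta\sqrt{\frac{nd}{\log d}}.$$
   Context: All graphs are finite, simple and undirected; $\log$ is the natural logarithm. For disjoint $A,B\subseteq V(G)$, $e_G(A,B)$ is the number of edges of $G$ with one endpoint in $A$ and the other in $B$. The Cheeger constant of a graph $G$ (with at least two vertices) is $$h(G)=\min\left\{\frac{e_G(S,V(G)\setminus S)}{|S|} : \emptyset\ne S\subseteq V(G),\ |S|\le\frac{|V(G)|}{2}\right\}.$$ A graph $H$ is a minor of $G$ if there is a family $(V_x)_{x\in V(H)}$ of pairwise disjoint nonempty subsets of $V(G)$ such that each $V_x$ induces a connected subgraph of $G$ and, whenever $xy\in E(H)$, $G$ has an edge between $V_x$ and $V_y$. The contraction clique number $\mathrm{ccl}(G)$ is the largest integer $t$ such that the complete graph $K_t$ is a minor of $G$. *)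

theory Defs
  imports Complex_Main "HOL-Library.Disjoint_Sets" "Graph_Theory.Graph_Theory"
begin

text \<open>
  Finite simple undirected graphs are the symmetric loopfree digraphs of the locale
  \<^locale>\<open>pair_graph\<close>: an edge \<open>uv\<close> is represented by the two arcs \<open>(u,v)\<close> and \<open>(v,u)\<close>, so
  \<^const>\<open>out_degree\<close> is the ordinary vertex degree.
\<close>

text \<open>For disjoint \<open>A\<close> and \<open>B\<close>, each edge between \<open>A\<close> and \<open>B\<close> has exactly one arc directed from
  \<open>A\<close> to \<open>B\<close>, so it is counted once.\<close>

definition edges_between :: "'a pair_pre_digraph \<Rightarrow> 'a set \<Rightarrow> 'a set \<Rightarrow> nat" where
  "edges_between G A B = card {(u, v). (u, v) \<in> parcs G \<and> u \<in> A \<and> v \<in> B}"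

text \<open>Meaningful only for graphs with at least two vertices; otherwise the minimum ranges over the
  empty set.\<close>

definition cheeger :: "'a pair_pre_digraph \<Rightarrow> real" where
  "cheeger G = Min {real (edges_between G S (pverts G - S)) / real (card S) | S.
     S \<noteq> {} \<and> S \<subseteq> pverts G \<and> real (card S) \<le> real (card (pverts G)) / 2}"

definition is_minor :: "'b pair_pre_digraph \<Rightarrow> 'a pair_pre_digraph \<Rightarrow> bool" where
  "is_minor H G \<longleftrightarrow> (\<exists>V :: 'b \<Rightarrow> 'a set.
     disjoint_family_on V (pverts H) \<and>
     (\<forall>x\<in>pverts H. V x \<noteq> {} \<and> V x \<subseteq> pverts G \<and> connected (with_proj G \<restriction> V x)) \<and>
     (\<forall>(x, y)\<in>parcs H. \<exists>u\<in>V x. \<exists>v\<in>V y. (u, v) \<in> parcs G))"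

definition complete_graph :: "nat \<Rightarrow> nat pair_pre_digraph" where
  "complete_graph t = \<lparr>pverts = {..<t}, parcs = {(i, j). i < t \<and> j < t \<and> i \<noteq> j}\<rparr>"

definition ccl :: "'a pair_pre_digraph \<Rightarrow> nat" where
  "ccl G = Max {t. is_minor (complete_graph t) G}"

lemma complete_digraph_complete_graph: "complete_digraph t (with_proj (complete_graph t))"
  unfolding complete_digraph_pair_def by (auto simp: complete_graph_def)

lemma pair_graph_complete_graph: "pair_graph (complete_graph t)"
  using complete_digraph_complete_graph by (rule pair_graphI_complete)

text \<open>The minimum and maximum above range over finite nonempty sets.\<close>

lemma cheeger_set_finite:
  assumes "finite (pverts G)"
  shows "finite {real (edges_between G S (pverts G - S)) / real (card S) | S.
     S \<noteq> {} \<and> S \<subseteq> pverts G \<and> real (card S) \<le> real (card (pverts G)) / 2}"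
proof (rule finite_subset)
  show "{real (edges_between G S (pverts G - S)) / real (card S) | S.
     S \<noteq> {} \<and> S \<subseteq> pverts G \<and> real (card S) \<le> real (card (pverts G)) / 2}
     \<subseteq> (\<lambda>S. real (edges_between G S (pverts G - S)) / real (card S)) ` Pow (pverts G)"
    by auto
qed (use assms in simp)

lemma cheeger_set_nonempty:
  assumes "card (pverts G) \<ge> 2"
  shows "{real (edges_between G S (pverts G - S)) / real (card S) | S.
     S \<noteq> {} \<and> S \<subseteq> pverts G \<and> real (card S) \<le> real (card (pverts G)) / 2} \<noteq> {}"
proof -
  obtain v where "v \<in> pverts G" using assms by fastforce
  then have "{v} \<noteq> {} \<and> {v} \<subseteq> pverts G \<and> real (card {v}) \<le> real (card (pverts G)) / 2"
    using assms by simp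
  then show ?thesis by blast
qed

lemma is_minor_complete_graph_0: "is_minor (complete_graph 0) G"
  by (auto simp: is_minor_def complete_graph_def disjoint_family_on_def)

lemma is_minor_complete_graph_le:
  assumes "finite (pverts G)" "is_minor (complete_graph t) G"
  shows "t \<le> card (pverts G)"
proof -
  from assms(2) obtain V :: "nat \<Rightarrow> 'a set"
    where V: "disjoint_family_on V {..<t}" "\<And>x. x < t \<Longrightarrow> V x \<noteq> {} \<and> V x \<subseteq> pverts G"
    by (auto simp: is_minor_def complete_graph_def)
  define f where "f x = (SOME u. u \<in> V x)" for x
  have f: "f x \<in> V x" if "x < t" for x
    using V(2)[OF that] unfolding f_def by (simp add: some_in_eq)
  have "inj_on f {..<t}"
  proof (rule inj_onI)
    fix x y assume xy: "x \<in> {..<t}" "y \<in> {..<t}" "f x = f y"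
    show "x = y"
    proof (rule ccontr)
      assume "x \<noteq> y"
      then have "V x \<inter> V y = {}" using V(1) xy by (auto simp: disjoint_family_on_def)
      with f[of x] f[of y] xy show False by auto
    qed
  qed
  moreover have "f ` {..<t} \<subseteq> pverts G" using f V(2) by blast
  ultimately have "card {..<t} \<le> card (pverts G)" using assms(1) by (rule card_inj_on_le)
  then show ?thesis by simp
qed

lemma is_minor_complete_graph_ccl:
  assumes "finite (pverts G)"
  shows "is_minor (complete_graph (ccl G)) G"
    and "is_minor (complete_graph t) G \<Longrightarrow> t \<le> ccl G"
proof -
  have fin: "finite {t. is_minor (complete_graph t) G}"
    using is_minor_complete_graph_le[OF assms] by (auto intro: finite_subset[of _ "{..card (pverts G)}"])
  have "ccl G \<in> {t. is_minor (complete_graph t) G}"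
    unfolding ccl_def using fin is_minor_complete_graph_0[of G] by (intro Max_in) auto
  then show "is_minor (complete_graph (ccl G)) G" by simp
  show "t \<le> ccl G" if "is_minor (complete_graph t) G"
    unfolding ccl_def using fin that by (intro Max_ge) auto
qed

end

theory Submission
  imports Defs "HOL-Analysis.Convex" "HOL-Library.Indicator_Function"
begin

text \<open>
  Branch sets of size about \<open>\<surd>(n ln d / d)\<close> are chosen one after the other, each as a random connected
  set \<open>W\<close> in an expander \<open>R\<close> consisting of almost all unused vertices.

  If \<open>d ln d\<close> is at most a small multiple of \<open>n\<close>, take a lazy random walk. By Cheeger's inequality it
  mixes fast, so it misses a set of density \<open>a\<close> with probability \<open>exp(- \<Omega>(a |W|))\<close>. Applied to the
  balls around the neighbourhood of an earlier branch set, whose sizes grow geometrically, this shows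
  that the expected distance from the walk to that neighbourhood is only \<open>O(1/d)\<close>. Hence
  shortest paths from the walk to all earlier branch sets cost few additional vertices, even though
  a union bound over the branch sets would fail.

  For larger \<open>d\<close> the walk mixes too slowly for its length, but there \<open>O(n/d)\<close> vertices suffice for a
  connected set at distance at most \<open>2\<close> from every vertex. So \<open>W\<close> may consist of independent
  uniform vertices joined to such a set, and a union bound works.
\<close>

subsection \<open>Connected sets and balls\<close>

text \<open>The size \<open>w\<close> of a branch set is fixed by d w^2 = n ln d: two such sets,
  each with about d w neighbours, miss each other with probability exp(- w * d w / n), a power of
  1/d. With about n / w sets the expected number of misses is about n / (w d) = w / ln d. In the
  sparse range this can be arbitrarily large, which rules out a union bound, but it is small against
  \<open>w\<close>, so the misses can be repaired by paths. In the dense range the number of sets is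
  O(d), and a union bound applies. The obstacle is that later sets live in ever smaller graphs
  \<open>R'\<close>, over which an earlier set has no control. What is kept for each branch set
  \<open>W\<close> is therefore a dichotomy for every \<open>R'\<close>: \<open>W\<close> still sees
  \<open>R'\<close> well, or it sends at most c d |W| edges there and can be discarded while the cut
  between the discarded part and the rest stays sparse. For a walk the dichotomy comes from a second
  moment bound; for independent samples, from the fact that nearly all of \<open>R\<close> is
  adjacent to \<open>W\<close>.\<close>

definition conn :: "('a \<times> 'a) set \<Rightarrow> 'a set \<Rightarrow> bool" where
  "conn E W \<longleftrightarrow> (\<forall>u\<in>W. \<forall>v\<in>W. (u, v) \<in> (E \<inter> W \<times> W)\<^sup>*)"

lemma conn_singleton: "conn E {x}"
  by (simp add: conn_def)

lemma conn_Un: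
  assumes "sym E" "conn E A" "conn E B" "x \<in> A" "y \<in> B" "x = y \<or> (x, y) \<in> E"
  shows "conn E (A \<union> B)"
proof -
  let ?r = "E \<inter> (A \<union> B) \<times> (A \<union> B)"
  have sym: "sym (?r\<^sup>*)"
    using assms(1) by (intro sym_rtrancl) (auto simp: sym_def)
  have A: "(u, v) \<in> ?r\<^sup>*" if "u \<in> A" "v \<in> A" for u v
    using assms(2) that rtrancl_mono[of "E \<inter> A \<times> A" ?r] by (auto simp: conn_def)
  have B: "(u, v) \<in> ?r\<^sup>*" if "u \<in> B" "v \<in> B" for u v
    using assms(3) that rtrancl_mono[of "E \<inter> B \<times> B" ?r] by (auto simp: conn_def)
  have xy: "(x, y) \<in> ?r\<^sup>*"
    using assms(4-6) by auto
  have AB: "(u, v) \<in> ?r\<^sup>*" if "u \<in> A" "v \<in> B" for u v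
    using A[OF that(1) assms(4)] xy B[OF assms(5) that(2)] by (meson rtrancl_trans)
  then have "(v, u) \<in> ?r\<^sup>*" if "u \<in> A" "v \<in> B" for u v
    using that sym by (auto dest: symD)
  with A B AB show ?thesis
    unfolding conn_def by blast
qed

lemma conn_UN:
  assumes "sym E" "conn E W" "finite I" "\<And>i. i \<in> I \<Longrightarrow> conn E (Q i) \<and> Q i \<inter> W \<noteq> {}"
  shows "conn E (W \<union> (\<Union>i\<in>I. Q i))"
  using assms(3,4)
proof (induction I rule: finite_induct)
  case empty
  then show ?case using assms(2) by simp
next
  case (insert i I)
  obtain x where "x \<in> Q i" "x \<in> W" using insert.prems by blast
  then have "conn E ((W \<union> (\<Union>i\<in>I. Q i)) \<union> Q i)"
    using insert \<open>x \<in> Q i\<close> \<open>x \<in> W\<close>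
    by (intro conn_Un[OF assms(1), where x = x and y = x and A = "W \<union> (\<Union>i\<in>I. Q i)" and B = "Q i"]) auto
  then show ?case by (simp add: Un_ac)
qed

text \<open>Equal neighbours in the list are allowed because the lazy walk may stay in
  place.\<close>

lemma conn_successively:
  assumes "sym E" "ws \<noteq> []" "successively (\<lambda>x y. x = y \<or> (x, y) \<in> E) ws"
  shows "conn E (set ws)"
  using assms(2,3)
proof (induction ws rule: induct_list012)
  case (3 x y zs)
  then have "conn E ({x} \<union> set (y # zs))"
    by (intro conn_Un[OF assms(1) conn_singleton, where x = x and y = y]) auto
  then show ?case by (simp add: insert_commute)
qed (auto simp: conn_singleton)

fun nball :: "('a \<times> 'a) set \<Rightarrow> 'a set \<Rightarrow> 'a set \<Rightarrow> nat \<Rightarrow> 'a set" where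
  "nball E R A 0 = A"
| "nball E R A (Suc r) = nball E R A r \<union> (E `` nball E R A r \<inter> R)"

lemma nball_subset: "A \<subseteq> R \<Longrightarrow> nball E R A r \<subseteq> R"
  by (induction r) auto

lemma nball_mono: "r \<le> s \<Longrightarrow> nball E R A r \<subseteq> nball E R A s"
  by (induction rule: dec_induct) auto

text \<open>A path of length at most \<open>r\<close>, recorded as a connected vertex set because
  only its size and its ends matter.\<close>

lemma nball_path:
  assumes "sym E" "A \<subseteq> R" "w \<in> nball E R A r"
  shows "\<exists>Q\<subseteq>R. finite Q \<and> conn E Q \<and> w \<in> Q \<and> Q \<inter> A \<noteq> {} \<and> card Q \<le> r + 1"
  using assms(3)
proof (induction r arbitrary: w)
  case 0
  then show ?case
    using assms(2) by (intro exI[of _ "{w}"]) (auto simp: conn_singleton)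
next
  case (Suc r)
  show ?case
  proof (cases "w \<in> nball E R A r")
    case True
    then show ?thesis using Suc.IH[OF True] by fastforce
  next
    case False
    then obtain u where u: "u \<in> nball E R A r" "(u, w) \<in> E" "w \<in> R"
      using Suc.prems by auto
    obtain Q where Q: "Q \<subseteq> R" "finite Q" "conn E Q" "u \<in> Q" "Q \<inter> A \<noteq> {}" "card Q \<le> r + 1"
      using Suc.IH[OF u(1)] by blast
    have "conn E (Q \<union> {w})"
      using Q(3,4) u(2) by (intro conn_Un[OF assms(1) _ conn_singleton, where x = u and y = w]) auto
    moreover have "card (Q \<union> {w}) \<le> Suc r + 1"
      using Q(6) card_Un_le[of Q "{w}"] by simp
    ultimately show ?thesis
      using Q u(3) by (intro exI[of _ "Q \<union> {w}"]) auto
  qed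
qed

subsection \<open>Markov chains with a spectral gap\<close>

definition visits :: "'a set \<Rightarrow> 'a list \<Rightarrow> real" where
  "visits B ws = (\<Sum>w\<leftarrow>ws. indicator B w)"

text \<open>Symmetry makes the uniform distribution stationary. The gap is put as a loss of variance
  under one application of \<open>K\<close>: all eigenvalues on mean-zero functions have square at
  most 1 - \<gamma>. This bounds both ends of the spectrum and avoids eigenvectors. The lazy walk
  and independent uniform sampling (\<gamma> = 1) are both instances.\<close>

locale mixing_kernel =
  fixes R :: "'a set" and K :: "'a \<Rightarrow> 'a \<Rightarrow> real" and \<gamma> :: real
  assumes finite_R: "finite R" and R_nonempty: "R \<noteq> {}"
    and K_nonneg: "\<And>x y. x \<in> R \<Longrightarrow> y \<in> R \<Longrightarrow> 0 \<le> K x y"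
    and K_sym: "\<And>x y. K x y = K y x"
    and K_sum: "\<And>x. x \<in> R \<Longrightarrow> (\<Sum>y\<in>R. K x y) = 1"
    and gap: "\<And>f. (\<Sum>x\<in>R. (\<Sum>y\<in>R. K x y * f y)\<^sup>2)
      \<le> (\<Sum>x\<in>R. (f x)\<^sup>2) - \<gamma> * ((\<Sum>x\<in>R. (f x)\<^sup>2) - (\<Sum>x\<in>R. f x)\<^sup>2 / card R)"
    and gap_pos: "0 < \<gamma>" and gap_le_1: "\<gamma> \<le> 1"
begin

definition step :: "('a \<Rightarrow> real) \<Rightarrow> 'a \<Rightarrow> real" where
  "step f x = (\<Sum>y\<in>R. K x y * f y)"

text \<open>\<open>walk_exp k x g\<close> is the expectation of \<open>g\<close> on the list of the \<open>k + 1\<close> states of the Markov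
  chain \<open>K\<close> started at \<open>x\<close>, and \<open>walk_mean k g\<close> its average over a uniform starting state.\<close>

fun walk_exp :: "nat \<Rightarrow> 'a \<Rightarrow> ('a list \<Rightarrow> real) \<Rightarrow> real" where
  "walk_exp 0 x g = g [x]"
| "walk_exp (Suc k) x g = step (\<lambda>y. walk_exp k y (\<lambda>ws. g (x # ws))) x"

definition walk_mean :: "nat \<Rightarrow> ('a list \<Rightarrow> real) \<Rightarrow> real" where
  "walk_mean k g = (\<Sum>x\<in>R. walk_exp k x g) / card R"

lemma card_R_pos: "0 < card R"
  using finite_R R_nonempty by (simp add: card_gt_0_iff)

lemma step_add: "step (\<lambda>y. f y + g y) x = step f x + step g x"
  by (simp add: step_def algebra_simps sum.distrib)

lemma step_cmult: "step (\<lambda>y. c * f y) x = c * step f x"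
  by (simp add: step_def sum_distrib_left mult_ac)

lemma step_cong: "(\<And>y. y \<in> R \<Longrightarrow> f y = g y) \<Longrightarrow> step f x = step g x"
  by (simp add: step_def)

lemma step_const: "x \<in> R \<Longrightarrow> step (\<lambda>y. c) x = c"
  by (simp add: step_def sum_distrib_right[symmetric] K_sum)

lemma sum_step: "(\<Sum>x\<in>R. step f x) = (\<Sum>x\<in>R. f x)"
proof -
  have "(\<Sum>x\<in>R. step f x) = (\<Sum>y\<in>R. \<Sum>x\<in>R. K x y * f y)"
    unfolding step_def by (rule sum.swap)
  also have "\<dots> = (\<Sum>y\<in>R. (\<Sum>x\<in>R. K y x) * f y)"
    by (simp add: sum_distrib_right K_sym)
  also have "\<dots> = (\<Sum>y\<in>R. f y)"
    by (simp add: K_sum)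
  finally show ?thesis .
qed

lemma walk_exp_add: "walk_exp k x (\<lambda>ws. f ws + g ws) = walk_exp k x f + walk_exp k x g"
  by (induction k arbitrary: x f g) (simp_all add: step_add)

lemma walk_exp_cmult: "walk_exp k x (\<lambda>ws. c * g ws) = c * walk_exp k x g"
  by (induction k arbitrary: x g) (simp_all add: step_cmult)

lemma walk_exp_const: "x \<in> R \<Longrightarrow> walk_exp k x (\<lambda>ws. c) = c"
proof (induction k arbitrary: x)
  case (Suc k)
  then show ?case
    using step_cong[of "\<lambda>y. walk_exp k y (\<lambda>ws. c)" "\<lambda>y. c" x] by (simp add: step_const)
qed simp

lemma walk_mean_add: "walk_mean k (\<lambda>ws. f ws + g ws) = walk_mean k f + walk_mean k g"
  by (simp add: walk_mean_def walk_exp_add sum.distrib add_divide_distrib)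

lemma walk_mean_cmult: "walk_mean k (\<lambda>ws. c * g ws) = c * walk_mean k g"
  by (simp add: walk_mean_def walk_exp_cmult sum_distrib_left)

lemma walk_mean_const: "walk_mean k (\<lambda>ws. c) = c"
  using card_R_pos by (simp add: walk_mean_def walk_exp_const)

lemma walk_mean_sum:
  "finite I \<Longrightarrow> walk_mean k (\<lambda>ws. \<Sum>i\<in>I. f i ws) = (\<Sum>i\<in>I. walk_mean k (f i))"
  by (induction I rule: finite_induct) (simp_all add: walk_mean_add walk_mean_const)

text \<open>Method of conditional expectations: among the successors of positive probability, one
  has conditional expectation of \<open>g\<close> at most the current value. This replaces a
  probability space.\<close>

lemma walk_exp_ex:
  assumes "x \<in> R"
  shows "\<exists>ws. length ws = k + 1 \<and> set ws \<subseteq> R \<and> hd ws = x \<and>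
    successively (\<lambda>x y. K x y > 0) ws \<and> g ws \<le> walk_exp k x g"
  using assms
proof (induction k arbitrary: x g)
  case 0
  then show ?case by (intro exI[of _ "[x]"]) auto
next
  case (Suc k)
  let ?F = "\<lambda>y. walk_exp k y (\<lambda>ws. g (x # ws))"
  have "\<exists>y\<in>R. K x y > 0 \<and> ?F y \<le> walk_exp (Suc k) x g"
  proof (rule ccontr)
    assume contra: "\<not> ?thesis"
    let ?c = "walk_exp (Suc k) x g"
    have le: "K x y * ?c \<le> K x y * ?F y" if "y \<in> R" for y
      using contra that K_nonneg[OF Suc.prems that]
      by (cases "K x y = 0") (auto intro!: mult_left_mono simp: less_le not_le)
    obtain y where y: "y \<in> R" "K x y > 0"
    proof -
      have "\<exists>y\<in>R. K x y \<noteq> 0"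
        using K_sum[OF Suc.prems] by (metis sum.neutral zero_neq_one)
      then show ?thesis
        using that K_nonneg[OF Suc.prems] by (metis less_le)
    qed
    then have "K x y * ?c < K x y * ?F y"
      using contra by (auto simp: not_le)
    then have "(\<Sum>y\<in>R. K x y * ?c) < (\<Sum>y\<in>R. K x y * ?F y)"
      using le y(1) finite_R by (intro sum_strict_mono_ex1) auto
    then show False
      using K_sum[OF Suc.prems] by (simp add: sum_distrib_right[symmetric] step_def)
  qed
  then obtain y where y: "y \<in> R" "K x y > 0" "?F y \<le> walk_exp (Suc k) x g" by blast
  obtain ws where ws: "length ws = k + 1" "set ws \<subseteq> R" "hd ws = y"
    "successively (\<lambda>x y. K x y > 0) ws" "g (x # ws) \<le> ?F y"
    using Suc.IH[OF y(1), of "\<lambda>ws. g (x # ws)"] by blast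
  then show ?case
    using y Suc.prems by (intro exI[of _ "x # ws"]) (auto simp: successively_Cons)
qed

lemma walk_mean_ex:
  "\<exists>ws. length ws = k + 1 \<and> set ws \<subseteq> R \<and>
    successively (\<lambda>x y. K x y > 0) ws \<and> g ws \<le> walk_mean k g"
proof -
  have "\<exists>x\<in>R. walk_exp k x g \<le> walk_mean k g"
  proof (rule ccontr)
    assume "\<not> ?thesis"
    then have "(\<Sum>x\<in>R. walk_mean k g) < (\<Sum>x\<in>R. walk_exp k x g)"
      using finite_R R_nonempty by (intro sum_strict_mono) (auto simp: not_le)
    then show False
      using card_R_pos by (simp add: walk_mean_def)
  qed
  then show ?thesis
    using walk_exp_ex by (meson order_trans)
qed

section \<open>Contraction of mean-zero functions and the second moment of visit counts\<close>

lemma step_iter_contract: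
  assumes "(\<Sum>x\<in>R. f x) = 0"
  shows "(\<Sum>x\<in>R. ((step ^^ j) f x)\<^sup>2) \<le> (1 - \<gamma>) ^ j * (\<Sum>x\<in>R. (f x)\<^sup>2)"
proof -
  have sum0: "(\<Sum>x\<in>R. (step ^^ j) f x) = 0" for j
    using assms by (induction j) (simp_all add: sum_step)
  show ?thesis
  proof (induction j)
    case (Suc j)
    have "(\<Sum>x\<in>R. ((step ^^ Suc j) f x)\<^sup>2) \<le> (1 - \<gamma>) * (\<Sum>x\<in>R. ((step ^^ j) f x)\<^sup>2)"
      using gap[of "(step ^^ j) f"] by (simp add: sum0 step_def algebra_simps)
    also have "\<dots> \<le> (1 - \<gamma>) * ((1 - \<gamma>) ^ j * (\<Sum>x\<in>R. (f x)\<^sup>2))"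
      using Suc.IH gap_le_1 by (intro mult_left_mono) auto
    finally show ?case by simp
  qed simp
qed

lemma step_iter_shift:
  "x \<in> R \<Longrightarrow> (step ^^ j) f x = (step ^^ j) (\<lambda>y. f y - c) x + c"
proof (induction j arbitrary: x)
  case (Suc j)
  have "step ((step ^^ j) f) x = step (\<lambda>y. (step ^^ j) (\<lambda>y. f y - c) y + c) x"
    using Suc.IH by (rule step_cong)
  then show ?case
    using Suc.prems by (simp add: step_add step_const)
qed simp

text \<open>The left side is |R| times the probability that a stationary walk is in \<open>B\<close>
  at times 0 and \<open>j\<close>. The mean part of the indicator gives the independent value |B|^2
  / |R|; the centred part \<open>g\<close> shrinks by \<open>sqrt (1 - \<gamma>)\<close> per step
  and is paired with \<open>B\<close> by Cauchy-Schwarz.\<close>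

lemma return_prob_le:
  assumes "B \<subseteq> R"
  shows "(\<Sum>x\<in>B. (step ^^ j) (indicator B) x)
    \<le> (real (card B))\<^sup>2 / card R + sqrt (1 - \<gamma>) ^ j * card B"
proof -
  let ?b = "indicator B :: 'a \<Rightarrow> real"
  define \<mu> where "\<mu> = real (card B) / card R"
  define g where "g y = ?b y - \<mu>" for y
  have finB: "finite B" using assms finite_R by (rule finite_subset)
  have sum_b: "(\<Sum>x\<in>R. ?b x) = card B"
    using assms finite_R by (simp add: indicator_def sum.If_cases Int_absorb1)
  have sum_g: "(\<Sum>x\<in>R. g x) = 0"
    using card_R_pos by (simp add: g_def sum_subtractf sum_b \<mu>_def)
  have "(\<Sum>x\<in>R. (g x)\<^sup>2) = (\<Sum>x\<in>R. ?b x - 2 * \<mu> * ?b x + \<mu>\<^sup>2)"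
    by (intro sum.cong) (auto simp: g_def power2_eq_square indicator_def algebra_simps)
  also have "\<dots> = card B - 2 * \<mu> * card B + card R * \<mu>\<^sup>2"
    by (simp add: sum.distrib sum_subtractf sum_b sum_distrib_left[symmetric])
  also have "\<dots> = card B - \<mu> * card B"
    using card_R_pos by (simp add: \<mu>_def power2_eq_square)
  also have "\<dots> \<le> card B"
    by (simp add: \<mu>_def)
  finally have norm_g: "(\<Sum>x\<in>R. (g x)\<^sup>2) \<le> card B" .
  let ?h = "(step ^^ j) g"
  have "(\<Sum>x\<in>B. ?h x * 1)\<^sup>2 \<le> (\<Sum>x\<in>B. (?h x)\<^sup>2) * (\<Sum>x\<in>B. 1\<^sup>2)"
    by (rule Cauchy_Schwarz_ineq_sum)
  also have "\<dots> \<le> (\<Sum>x\<in>R. (?h x)\<^sup>2) * card B"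
    using assms finite_R by (intro mult_mono sum_mono2 sum_nonneg) auto
  also have "\<dots> \<le> ((1 - \<gamma>) ^ j * card B) * card B"
    using step_iter_contract[OF sum_g, of j] mult_left_mono[OF norm_g, of "(1 - \<gamma>) ^ j"] gap_le_1
    by (intro mult_right_mono) auto
  finally have le: "(\<Sum>x\<in>B. ?h x * 1)\<^sup>2 \<le> ((1 - \<gamma>) ^ j * card B) * card B" .
  have eq: "((1 - \<gamma>) ^ j * card B) * card B = (sqrt (1 - \<gamma>) ^ j * card B)\<^sup>2"
  proof -
    have "(sqrt (1 - \<gamma>) ^ j)\<^sup>2 = ((sqrt (1 - \<gamma>))\<^sup>2) ^ j"
      by (simp only: power_mult[symmetric] mult.commute)
    then show ?thesis
      using gap_le_1 by (simp add: power_mult_distrib) (simp add: power2_eq_square)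
  qed
  have "(\<Sum>x\<in>B. ?h x) \<le> sqrt (1 - \<gamma>) ^ j * card B"
    using power2_le_imp_le[OF ord_le_eq_trans[OF le eq]] gap_le_1 by simp
  moreover have "(\<Sum>x\<in>B. (step ^^ j) ?b x) = (\<Sum>x\<in>B. ?h x + \<mu>)"
    using assms by (intro sum.cong refl) (auto simp: g_def[abs_def] intro!: step_iter_shift)
  ultimately show ?thesis
    by (simp add: sum.distrib \<mu>_def power2_eq_square)
qed

lemma walk_exp_visits:
  "x \<in> R \<Longrightarrow> walk_exp k x (visits B) = (\<Sum>j\<le>k. (step ^^ j) (indicator B) x)"
proof (induction k arbitrary: x)
  case 0
  then show ?case by (simp add: visits_def)
next
  case (Suc k)
  have [simp]: "visits B (x # ws) = indicator B x + visits B ws" for ws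
    by (simp add: visits_def)
  have "walk_exp (Suc k) x (visits B) = step (\<lambda>y. indicator B x + walk_exp k y (visits B)) x"
    by (simp add: walk_exp_add) (intro step_cong, simp add: walk_exp_const)
  also have "\<dots> = indicator B x + step (\<lambda>y. \<Sum>j\<le>k. (step ^^ j) (indicator B) y) x"
    using Suc by (simp add: step_add step_const cong: step_cong)
  also have "step (\<lambda>y. \<Sum>j\<le>k. (step ^^ j) (indicator B) y) x = (\<Sum>j\<le>k. (step ^^ Suc j) (indicator B) x)"
    by (simp add: step_def sum_distrib_left) (rule sum.swap)
  finally show ?case
    by (simp add: sum.atMost_Suc_shift del: sum.atMost_Suc)
qed

text \<open>Splitting off the first state turns the square into a diagonal term, a cross term with
  all later visits, and the square for the shorter walk. Cross terms are sums of return
  probabilities: their independent parts are equal, and their correlated parts form a geometric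
  series.\<close>

lemma sum_walk_exp_visits_sq:
  assumes "B \<subseteq> R"
  defines "\<sigma> \<equiv> sqrt (1 - \<gamma>)"
  shows "(\<Sum>x\<in>R. walk_exp k x (\<lambda>ws. (visits B ws)\<^sup>2))
    \<le> (k + 1) * (card B + 2 * ((k + 1) * (real (card B))\<^sup>2 / card R + card B / (1 - \<sigma>)))"
proof (induction k)
  have \<sigma>: "0 \<le> \<sigma>" "\<sigma> < 1" using gap_le_1 gap_pos by (auto simp: \<sigma>_def)
  let ?b = "indicator B :: 'a \<Rightarrow> real"
  have sum_b: "(\<Sum>x\<in>R. ?b x) = card B"
    using assms finite_R by (simp add: indicator_def sum.If_cases Int_absorb1)
  {
    case 0
    have "(\<Sum>x\<in>R. walk_exp 0 x (\<lambda>ws. (visits B ws)\<^sup>2)) = (\<Sum>x\<in>R. ?b x)"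
      by (intro sum.cong) (auto simp: visits_def indicator_def)
    also have "\<dots> \<le> card B + 2 * (1 * (real (card B))\<^sup>2 / card R + card B / (1 - \<sigma>))"
      using \<sigma> by (simp add: sum_b)
    finally show ?case by simp
  next
    case (Suc k)
    \<comment> \<open>\<open>T k\<close> bounds the cross term of a first state with
      \<open>k + 1\<close> later ones; since it increases with \<open>k\<close>, all states may be
      charged at the largest value.\<close>
    define T where "T k = (1 + real k) * (real (card B))\<^sup>2 / card R + card B / (1 - \<sigma>)" for k
    have T_mono: "T k \<le> T (Suc k)"
      unfolding T_def using \<sigma> by (intro add_mono divide_right_mono mult_right_mono) auto
    have eq: "walk_exp (Suc k) x (\<lambda>ws. (visits B ws)\<^sup>2)
      = ?b x + 2 * (?b x * (\<Sum>j\<le>k. (step ^^ Suc j) ?b x))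
        + step (\<lambda>y. walk_exp k y (\<lambda>ws. (visits B ws)\<^sup>2)) x" if "x \<in> R" for x
    proof -
      have vis: "(visits B (x # ws))\<^sup>2 = (?b x + (2 * ?b x) * visits B ws) + (visits B ws)\<^sup>2" for ws
        by (simp add: visits_def indicator_def power2_eq_square algebra_simps)
      have "walk_exp (Suc k) x (\<lambda>ws. (visits B ws)\<^sup>2) =
          step (\<lambda>y. (?b x + (2 * ?b x) * walk_exp k y (visits B)) + walk_exp k y (\<lambda>ws. (visits B ws)\<^sup>2)) x"
        unfolding walk_exp.simps vis
        by (intro step_cong) (simp only: walk_exp_add walk_exp_cmult walk_exp_const)
      also have "\<dots> = ?b x + 2 * ?b x * step (\<lambda>y. walk_exp k y (visits B)) x
          + step (\<lambda>y. walk_exp k y (\<lambda>ws. (visits B ws)\<^sup>2)) x"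
        using that by (simp only: step_add step_cmult step_const)
      also have "step (\<lambda>y. walk_exp k y (visits B)) x = step (\<lambda>y. \<Sum>j\<le>k. (step ^^ j) ?b y) x"
        by (intro step_cong) (simp add: walk_exp_visits)
      also have "\<dots> = (\<Sum>j\<le>k. (step ^^ Suc j) ?b x)"
        by (simp add: step_def sum_distrib_left) (rule sum.swap)
      finally show ?thesis by simp
    qed
    have cross: "(\<Sum>x\<in>R. ?b x * (\<Sum>j\<le>k. (step ^^ Suc j) ?b x)) \<le> T k"
    proof -
      have "(\<Sum>x\<in>R. ?b x * (\<Sum>j\<le>k. (step ^^ Suc j) ?b x)) = (\<Sum>x\<in>B. \<Sum>j\<le>k. (step ^^ Suc j) ?b x)"
        using assms finite_R by (intro sum.mono_neutral_cong_right) (auto simp: indicator_def)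
      also have "\<dots> = (\<Sum>j\<le>k. \<Sum>x\<in>B. (step ^^ Suc j) ?b x)"
        by (rule sum.swap)
      also have "\<dots> \<le> (\<Sum>j\<le>k. (real (card B))\<^sup>2 / card R + \<sigma> ^ Suc j * card B)"
        unfolding \<sigma>_def by (intro sum_mono return_prob_le assms)
      also have "\<dots> = (k + 1) * ((real (card B))\<^sup>2 / card R) + (\<Sum>j\<le>k. \<sigma> ^ Suc j) * card B"
        by (simp add: sum.distrib sum_distrib_right)
      also have "(\<Sum>j\<le>k. \<sigma> ^ Suc j) \<le> 1 / (1 - \<sigma>)"
      proof -
        have "(\<Sum>j\<le>k. \<sigma> ^ Suc j) \<le> (\<Sum>j\<in>{..<Suc k}. \<sigma> ^ j)"
          unfolding lessThan_Suc_atMost using \<sigma>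
          by (intro sum_mono power_decreasing) auto
        also have "\<dots> = (1 - \<sigma> ^ Suc k) / (1 - \<sigma>)"
          using \<sigma> by (simp add: sum_gp_strict del: sum.lessThan_Suc)
        also have "\<dots> \<le> 1 / (1 - \<sigma>)"
          using \<sigma> by (intro divide_right_mono) auto
        finally show ?thesis .
      qed
      finally show ?thesis by (simp add: T_def mult_right_mono)
    qed
    have IH: "(\<Sum>x\<in>R. walk_exp k x (\<lambda>ws. (visits B ws)\<^sup>2)) \<le> (real k + 1) * (card B + 2 * T k)"
      using Suc.IH by (simp add: T_def add.commute)
    have "(\<Sum>x\<in>R. walk_exp (Suc k) x (\<lambda>ws. (visits B ws)\<^sup>2))
      = card B + 2 * (\<Sum>x\<in>R. ?b x * (\<Sum>j\<le>k. (step ^^ Suc j) ?b x))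
        + (\<Sum>x\<in>R. walk_exp k x (\<lambda>ws. (visits B ws)\<^sup>2))"
      by (simp only: eq sum.distrib sum_step sum_b sum_distrib_left[symmetric] cong: sum.cong)
    also have "\<dots> \<le> card B + 2 * T k + (real k + 1) * (card B + 2 * T k)"
      using cross IH by linarith
    also have "\<dots> = (real k + 2) * (card B + 2 * T k)"
      by (simp add: algebra_simps)
    also have "\<dots> \<le> (real k + 2) * (card B + 2 * T (Suc k))"
      using T_mono by (intro mult_left_mono) auto
    finally show ?case by (simp add: T_def add.commute)
  }
qed

section \<open>Probability that the walk stays inside a set\<close>

lemma walk_exp_avoid_Suc:
  assumes "x \<in> R"
  shows "walk_exp (Suc k) x (\<lambda>ws. of_bool (set ws \<subseteq> Z))
    = of_bool (x \<in> Z) * step (\<lambda>y. walk_exp k y (\<lambda>ws. of_bool (set ws \<subseteq> Z))) x"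
proof -
  have "of_bool (set (x # ws) \<subseteq> Z) = (of_bool (x \<in> Z) * of_bool (set ws \<subseteq> Z) :: real)" for ws
    by simp
  then show ?thesis
    unfolding walk_exp.simps by (simp only: walk_exp_cmult step_cmult)
qed

text \<open>For functions supported on \<open>Z\<close> the mean term in the gap is at most
  \<open>z\<close> times the squared norm, by Cauchy-Schwarz, so a step followed by restriction to
  \<open>Z\<close> multiplies the squared norm by at most 1 - \<gamma> (1 - z). The leading factor
  \<open>z\<close> comes from the uniform start; it later makes sums over radii converge.\<close>

lemma walk_avoid_le:
  assumes "Z \<subseteq> R"
  defines "z \<equiv> real (card Z) / card R"
  shows "walk_mean k (\<lambda>ws. of_bool (set ws \<subseteq> Z)) \<le> z * sqrt (1 - \<gamma> * (1 - z)) ^ k"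
proof -
  let ?F = "\<lambda>k x. walk_exp k x (\<lambda>ws. of_bool (set ws \<subseteq> Z))"
  let ?\<rho> = "1 - \<gamma> * (1 - z)"
  have finZ: "finite Z" using assms(1) finite_R by (rule finite_subset)
  have "card Z \<le> card R" using assms(1) finite_R by (simp add: card_mono)
  then have z: "0 \<le> z" "z \<le> 1"
    using card_R_pos by (auto simp: z_def)
  have "\<gamma> * (1 - z) \<le> 1 * 1"
    using z gap_pos gap_le_1 by (intro mult_mono) auto
  then have \<rho>: "0 \<le> ?\<rho>" by simp
  have supp: "?F k x = 0" if "x \<in> R - Z" for k x
    using that by (cases k) (auto simp: walk_exp_avoid_Suc simp del: walk_exp.simps(2))
  have bound: "(\<Sum>x\<in>R. (?F k x)\<^sup>2) \<le> ?\<rho> ^ k * card Z" for k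
  proof (induction k)
    case 0
    have "(\<Sum>x\<in>R. (?F 0 x)\<^sup>2) = (\<Sum>x\<in>Z. 1)"
      using assms(1) finite_R by (intro sum.mono_neutral_cong_right) auto
    then show ?case by simp
  next
    case (Suc k)
    let ?S = "\<Sum>x\<in>R. (?F k x)\<^sup>2"
    have "(\<Sum>x\<in>R. (?F (Suc k) x)\<^sup>2) \<le> (\<Sum>x\<in>R. (step (?F k) x)\<^sup>2)"
      by (intro sum_mono) (auto simp: walk_exp_avoid_Suc simp del: walk_exp.simps(2))
    also have "\<dots> \<le> ?S - \<gamma> * (?S - (\<Sum>x\<in>R. ?F k x)\<^sup>2 / card R)"
      using gap[of "?F k"] by (simp add: step_def)
    also have "\<dots> \<le> ?S - \<gamma> * (?S - z * ?S)"
    proof -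
      have "(\<Sum>x\<in>R. ?F k x) = (\<Sum>x\<in>Z. 1 * ?F k x)"
        using assms(1) finite_R supp by (intro sum.mono_neutral_cong_right) auto
      then have "(\<Sum>x\<in>R. ?F k x)\<^sup>2 \<le> (\<Sum>x\<in>Z. 1\<^sup>2) * (\<Sum>x\<in>Z. (?F k x)\<^sup>2)"
        by (simp only: Cauchy_Schwarz_ineq_sum)
      also have "\<dots> \<le> card Z * ?S"
        using assms(1) finite_R by (auto intro!: mult_left_mono sum_mono2)
      finally have "(\<Sum>x\<in>R. ?F k x)\<^sup>2 / card R \<le> z * ?S"
        using card_R_pos by (simp add: z_def divide_right_mono)
      then show ?thesis
        using gap_pos by (intro diff_left_mono mult_left_mono) auto
    qed
    also have "\<dots> = ?\<rho> * ?S" by (simp add: algebra_simps)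
    also have "\<dots> \<le> ?\<rho> * (?\<rho> ^ k * card Z)"
      using Suc.IH \<rho> by (rule mult_left_mono)
    finally show ?case by simp
  qed
  have "(\<Sum>x\<in>R. ?F k x) = (\<Sum>x\<in>Z. 1 * ?F k x)"
    using assms(1) finite_R supp by (intro sum.mono_neutral_cong_right) auto
  then have "(\<Sum>x\<in>R. ?F k x)\<^sup>2 \<le> (\<Sum>x\<in>Z. 1\<^sup>2) * (\<Sum>x\<in>Z. (?F k x)\<^sup>2)"
    by (simp only: Cauchy_Schwarz_ineq_sum)
  also have "\<dots> \<le> card Z * (\<Sum>x\<in>R. (?F k x)\<^sup>2)"
    using assms(1) finite_R by (auto intro!: mult_left_mono sum_mono2)
  also have "\<dots> \<le> card Z * (?\<rho> ^ k * card Z)"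
    by (intro mult_left_mono bound) auto
  finally have le: "(\<Sum>x\<in>R. ?F k x)\<^sup>2 \<le> card Z * (?\<rho> ^ k * card Z)" .
  have eq: "card Z * (?\<rho> ^ k * card Z) = (card Z * sqrt ?\<rho> ^ k)\<^sup>2"
  proof -
    have "(sqrt ?\<rho> ^ k)\<^sup>2 = ((sqrt ?\<rho>)\<^sup>2) ^ k"
      by (simp only: power_mult[symmetric] mult.commute)
    then show ?thesis
      using \<rho> by (simp add: power_mult_distrib) (simp add: power2_eq_square)
  qed
  have "(\<Sum>x\<in>R. ?F k x) \<le> card Z * sqrt ?\<rho> ^ k"
    by (rule power2_le_imp_le[OF ord_le_eq_trans[OF le eq]]) (use \<rho> in simp)
  then show ?thesis
    unfolding walk_mean_def z_def by (simp add: divide_right_mono)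
qed

lemma walk_avoid_exp_le:
  assumes "Z \<subseteq> R"
  defines "z \<equiv> real (card Z) / card R"
  shows "walk_mean k (\<lambda>ws. of_bool (set ws \<subseteq> Z)) \<le> z * exp (- \<gamma> * (1 - z) * k / 2)"
proof -
  have "1 - \<gamma> * (1 - z) \<le> exp (- (\<gamma> * (1 - z)))"
    using exp_ge_add_one_self[of "- (\<gamma> * (1 - z))"] by simp
  also have "\<dots> = (exp (- \<gamma> * (1 - z) / 2))\<^sup>2"
    by (simp add: power2_eq_square mult_exp_exp)
  finally have "sqrt (1 - \<gamma> * (1 - z)) \<le> exp (- \<gamma> * (1 - z) / 2)"
    by (intro real_le_lsqrt) auto
  moreover have "0 \<le> 1 - \<gamma> * (1 - z)"
  proof -
    have "0 \<le> z" "z \<le> 1"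
      using card_mono[OF finite_R assms(1)] card_R_pos by (auto simp: z_def)
    then have "\<gamma> * (1 - z) \<le> 1 * 1"
      using gap_pos gap_le_1 by (intro mult_mono) auto
    then show ?thesis by simp
  qed
  ultimately have "sqrt (1 - \<gamma> * (1 - z)) ^ k \<le> exp (- \<gamma> * (1 - z) / 2) ^ k"
    by (intro power_mono) auto
  also have "\<dots> = exp (- \<gamma> * (1 - z) * k / 2)"
    by (simp only: exp_of_nat_mult[symmetric]) (simp add: mult_ac)
  finally have "z * sqrt (1 - \<gamma> * (1 - z)) ^ k \<le> z * exp (- \<gamma> * (1 - z) * k / 2)"
    by (intro mult_left_mono) (auto simp: z_def)
  then show ?thesis
    using walk_avoid_le[OF assms(1), of k] by (simp add: z_def)
qed

end

subsection \<open>Expanders and the Cheeger inequality\<close>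

lemma card_edges_eq_sum:
  assumes "finite A" "finite B"
  shows "card (E \<inter> A \<times> B) = (\<Sum>x\<in>A. card (E `` {x} \<inter> B))"
proof -
  have "E \<inter> A \<times> B = Sigma A (\<lambda>x. E `` {x} \<inter> B)" by auto
  then show ?thesis using assms by simp
qed

lemma card_edges_sym:
  assumes "sym E"
  shows "card (E \<inter> A \<times> B) = card (E \<inter> B \<times> A)"
proof (rule bij_betw_same_card)
  show "bij_betw prod.swap (E \<inter> A \<times> B) (E \<inter> B \<times> A)"
    using assms by (intro bij_betw_byWitness[where f' = prod.swap]) (auto dest: symD)
qed

lemma card_edges_le:
  assumes "finite A" "finite B" "\<And>x. x \<in> A \<Longrightarrow> real (card (E `` {x} \<inter> B)) \<le> d"
  shows "real (card (E \<inter> A \<times> B)) \<le> d * card A"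
proof -
  have "real (card (E \<inter> A \<times> B)) = (\<Sum>x\<in>A. real (card (E `` {x} \<inter> B)))"
    using assms by (simp add: card_edges_eq_sum)
  also have "\<dots> \<le> (\<Sum>x\<in>A. d)"
    using assms(3) by (rule sum_mono)
  finally show ?thesis by (simp add: mult.commute)
qed

text \<open>The witness is the least attained value with at most half of \<open>R\<close> above it.
  The next smaller attained value has more than half above it, so fewer than half of the points lie
  below the witness. A median splits a function into two parts supported on at most half of
  \<open>R\<close>, the sets to which expansion applies.\<close>

lemma median_exists:
  fixes f :: "'a \<Rightarrow> real"
  assumes "finite R" "R \<noteq> {}"
  shows "\<exists>m. 2 * card {x\<in>R. f x > m} \<le> card R \<and> 2 * card {x\<in>R. f x < m} \<le> card R"
proof -
  define M where "M = {m \<in> f ` R. 2 * card {x\<in>R. f x > m} \<le> card R}"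
  have empty: "{x\<in>R. f x > Max (f ` R)} = {}"
    using assms by (auto simp: not_less)
  have "Max (f ` R) \<in> M"
    using assms unfolding M_def by (auto simp only: empty mem_Collect_eq intro!: Max_in) auto
  moreover have "finite M" using assms by (auto simp: M_def)
  ultimately have m: "Min M \<in> M" "\<And>y. y \<in> M \<Longrightarrow> Min M \<le> y"
    by (auto intro: Min_in)
  have "2 * card {x\<in>R. f x < Min M} \<le> card R"
  proof (cases "{x\<in>R. f x < Min M} = {}")
    case True
    then show ?thesis by (simp only: card.empty)
  next
    case False
    let ?L = "{x\<in>R. f x < Min M}"
    define m' where "m' = Max (f ` ?L)"
    have fin: "finite ?L" using assms by simp
    have "m' \<in> f ` ?L" unfolding m'_def using fin False by (intro Max_in) auto
    then have m': "m' \<in> f ` R" "m' < Min M" by auto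
    then have "m' \<notin> M" using m(2) by force
    with m'(1) have "card R < 2 * card {x\<in>R. f x > m'}" by (auto simp: M_def)
    moreover have "f x \<le> m'" if "x \<in> ?L" for x
      unfolding m'_def using fin that by (intro Max_ge) auto
    then have "?L \<inter> {x\<in>R. f x > m'} = {}"
      by (fastforce simp: not_less)
    then have "card ?L + card {x\<in>R. f x > m'} = card (?L \<union> {x\<in>R. f x > m'})"
      using assms by (intro card_Un_disjoint[symmetric]) auto
    moreover have "card (?L \<union> {x\<in>R. f x > m'}) \<le> card R"
      using assms by (intro card_mono) auto
    ultimately show ?thesis by linarith
  qed
  with m(1) show ?thesis by (auto simp: M_def)
qed

text \<open>Edge expansion of the graph induced on \<open>R\<close>, in units of the degree bound
  \<open>d\<close>. Since \<open>card_R\<close> admits singletons, all degrees lie between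
  \<open>c * d\<close> and \<open>d\<close>: the graph is regular up to a constant factor.\<close>

locale expander =
  fixes E :: "('a \<times> 'a) set" and R :: "'a set" and c d :: real
  assumes finite_R: "finite R" and card_R: "2 \<le> card R"
    and sym_E: "sym E"
    and degree_le: "\<And>x. x \<in> R \<Longrightarrow> real (card (E `` {x} \<inter> R)) \<le> d"
    and expansion: "\<And>S. S \<subseteq> R \<Longrightarrow> 2 * card S \<le> card R
      \<Longrightarrow> c * d * real (card S) \<le> real (card (E \<inter> S \<times> (R - S)))"
    and c_pos: "0 < c" and c_le_1: "c \<le> 1" and d_pos: "0 < d"
begin

lemma R_nonempty: "R \<noteq> {}"
  using card_R by auto

lemma degree_le_subset:
  assumes "x \<in> R" "B \<subseteq> R"
  shows "real (card (E `` {x} \<inter> B)) \<le> d"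
proof -
  have "card (E `` {x} \<inter> B) \<le> card (E `` {x} \<inter> R)"
    using assms finite_R by (intro card_mono) auto
  then show ?thesis using degree_le[OF assms(1)] by linarith
qed

lemma edges_le_left:
  assumes "A \<subseteq> R" "B \<subseteq> R"
  shows "real (card (E \<inter> A \<times> B)) \<le> d * card A"
  using assms finite_R degree_le_subset
  by (intro card_edges_le) (auto intro: finite_subset)

lemma edges_le_right:
  assumes "A \<subseteq> R" "B \<subseteq> R"
  shows "real (card (E \<inter> A \<times> B)) \<le> d * card B"
  using edges_le_left[OF assms(2,1)] by (simp add: card_edges_sym[OF sym_E, of A])

lemma degree_ge:
  assumes "x \<in> R"
  shows "c * d \<le> real (card (E `` {x} \<inter> R))"
proof -
  have "c * d * real (card {x}) \<le> real (card (E \<inter> {x} \<times> (R - {x})))"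
    using assms card_R by (intro expansion) auto
  also have "\<dots> = real (card (E `` {x} \<inter> (R - {x})))"
    using finite_R by (simp add: card_edges_eq_sum)
  also have "\<dots> \<le> real (card (E `` {x} \<inter> R))"
    using finite_R by (auto intro!: card_mono)
  finally show ?thesis by simp
qed

text \<open>At least c d |A| edges leave \<open>A\<close>, and each new vertex absorbs at most
  \<open>d\<close> of them.\<close>

lemma nball_grow:
  assumes "A \<subseteq> R" "2 * card A \<le> card R"
  shows "(1 + c) * real (card A) \<le> real (card (A \<union> (E `` A \<inter> R)))"
proof -
  let ?N = "E `` A \<inter> (R - A)"
  have "c * d * real (card A) \<le> real (card (E \<inter> A \<times> (R - A)))"
    using assms by (rule expansion)
  also have "E \<inter> A \<times> (R - A) = E \<inter> A \<times> ?N" by auto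
  also have "real (card (E \<inter> A \<times> ?N)) \<le> d * card ?N"
    using assms by (intro edges_le_right) auto
  finally have "c * card A \<le> card ?N"
    using d_pos by (simp add: mult.left_commute mult.assoc)
  moreover have "card (A \<union> (E `` A \<inter> R)) = card A + card ?N"
  proof -
    have "A \<union> (E `` A \<inter> R) = A \<union> ?N" by auto
    then show ?thesis
      using finite_R finite_subset[OF assms(1) finite_R]
      by (subst card_Un_disjoint[symmetric]) auto
  qed
  ultimately show ?thesis by (simp add: algebra_simps)
qed

text \<open>Growth seen from outside: the neighbours of what the enlarged set misses avoid
  \<open>A\<close>, so the growth of \<open>Z\<close> is the shrinking of the complement. This takes
  over once a ball exceeds half of \<open>R\<close>.\<close>

lemma nball_compl_shrink:
  assumes "A \<subseteq> R"
  defines "Z \<equiv> R - (A \<union> (E `` A \<inter> R))"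
  assumes "2 * card Z \<le> card R"
  shows "(1 + c) * real (card Z) \<le> real (card (R - A))"
proof -
  have "card (Z \<union> (E `` Z \<inter> R)) \<le> card (R - A)"
    using finite_R sym_E by (intro card_mono) (auto simp: Z_def dest: symD)
  moreover have "(1 + c) * real (card Z) \<le> real (card (Z \<union> (E `` Z \<inter> R)))"
    using assms by (intro nball_grow) auto
  ultimately show ?thesis by linarith
qed

lemma closed_eq_R:
  assumes "S \<subseteq> R" "S \<noteq> {}" "E `` S \<inter> R \<subseteq> S"
  shows "S = R"
proof (rule ccontr)
  assume "S \<noteq> R"
  have fin: "finite S" using assms(1) finite_R by (rule finite_subset)
  have pos: "0 < card S" "0 < card (R - S)"
    using assms \<open>S \<noteq> R\<close> fin finite_R by (auto simp: card_gt_0_iff)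
  have sum: "card S + card (R - S) = card R"
    using assms(1) finite_R by (metis card_Diff_subset card_mono fin le_add_diff_inverse)
  have S: "E \<inter> S \<times> (R - S) = {}"
    using assms(3) by auto
  have "E \<inter> (R - S) \<times> S = {}"
    using assms(1,3) sym_E by (auto dest: symD)
  then have RS: "E \<inter> (R - S) \<times> (R - (R - S)) = {}" by auto
  have "2 * card S \<le> card R \<or> 2 * card (R - S) \<le> card R"
    using sum by linarith
  then show False
    using expansion[of S] expansion[of "R - S"] pos assms(1) S RS c_pos d_pos
    by (auto simp: mult_le_0_iff)
qed

text \<open>A ball other than \<open>R\<close> gains a vertex at every step. Thus
  \<open>card R\<close> is a safe radius at which sums over distances can be cut off.\<close>

lemma nball_eq_R:
  assumes "A \<subseteq> R" "A \<noteq> {}"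
  shows "nball E R A (card R) = R"
proof -
  have "nball E R A r = R \<or> r < card (nball E R A r)" for r
  proof (induction r)
    case 0
    then show ?case
      using assms finite_R by (auto simp: card_gt_0_iff finite_subset)
  next
    case (Suc r)
    let ?B = "nball E R A r"
    have sub: "?B \<subseteq> R" "nball E R A (Suc r) \<subseteq> R" "A \<subseteq> ?B"
      using nball_subset[OF assms(1)] nball_mono[of 0 r E R A] by auto
    show ?case
    proof (cases "?B = R")
      case True
      then show ?thesis by auto
    next
      case False
      then have "\<not> E `` ?B \<inter> R \<subseteq> ?B"
        using closed_eq_R[OF sub(1)] assms(2) sub(3) by auto
      then have "?B \<subset> nball E R A (Suc r)" by auto
      then have "card ?B < card (nball E R A (Suc r))"
        using sub finite_R by (intro psubset_card_mono) (auto intro: finite_subset simp del: nball.simps)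
      then show ?thesis using Suc.IH False by linarith
    qed
  qed
  from this[of "card R"] show ?thesis
    using nball_subset[OF assms(1)] finite_R by (metis card_mono not_less)
qed

section \<open>The Dirichlet form, Cheeger's inequality and the lazy walk\<close>

abbreviation adj :: "'a \<Rightarrow> 'a \<Rightarrow> real" where
  "adj x y \<equiv> of_bool ((x, y) \<in> E)"

lemma adj_sym: "adj x y = adj y x"
  using sym_E by (auto dest: symD)

lemma sum_adj: "B \<subseteq> R \<Longrightarrow> (\<Sum>y\<in>B. adj x y) = card (E `` {x} \<inter> B)"
  using finite_R by (simp add: of_bool_def sum.If_cases Image_def Int_def conj_commute finite_subset)

lemma sum_adj_swap: "(\<Sum>x\<in>R. \<Sum>y\<in>R. adj x y * f y x) = (\<Sum>x\<in>R. \<Sum>y\<in>R. adj x y * f x y)"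
  by (subst sum.swap) (simp only: adj_sym)

text \<open>The sum is over ordered pairs, so every edge counts twice.\<close>

definition dirichlet :: "('a \<Rightarrow> real) \<Rightarrow> real" where
  "dirichlet f = (\<Sum>x\<in>R. \<Sum>y\<in>R. adj x y * (f x - f y)\<^sup>2)"

lemma dirichlet_nonneg: "0 \<le> dirichlet f"
  by (simp add: dirichlet_def sum_nonneg)

text \<open>Peel off one level at a time: subtracting the least positive value \<open>m\<close> on
  the support \<open>S\<close> makes the support smaller, and the indicator of \<open>S\<close>
  satisfies the bound by expansion. The factor 2 counts ordered pairs.\<close>

lemma coarea:
  assumes "\<And>x. x \<in> R \<Longrightarrow> 0 \<le> u x" "2 * card {x\<in>R. u x > 0} \<le> card R"
  shows "2 * c * d * (\<Sum>x\<in>R. u x) \<le> (\<Sum>x\<in>R. \<Sum>y\<in>R. adj x y * \<bar>u x - u y\<bar>)"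
  using assms
proof (induction "card {x\<in>R. u x > 0}" arbitrary: u rule: less_induct)
  case less
  define S where "S = {x\<in>R. u x > 0}"
  have finS: "finite S" using finite_R by (simp add: S_def)
  have out: "u x = 0" if "x \<in> R - S" for x
    using that less.prems(1)[of x] by (auto simp: S_def)
  show ?case
  proof (cases "S = {}")
    case True
    then have "(\<Sum>x\<in>R. u x) = 0" using out by (intro sum.neutral) auto
    then show ?thesis by (auto intro!: sum_nonneg)
  next
    case False
    define m where "m = Min (u ` S)"
    have "m \<in> u ` S" unfolding m_def using finS False by (intro Min_in) auto
    then obtain s where s: "s \<in> S" "u s = m" by auto
    have m_pos: "m > 0" using s by (auto simp: S_def)
    have m_le: "m \<le> u x" if "x \<in> S" for x
      using that finS by (auto simp: m_def)
    define u' where "u' x = u x - m * of_bool (x \<in> S)" for x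
    have supp: "{x\<in>R. u' x > 0} \<subseteq> S - {s}"
    proof
      fix x assume "x \<in> {x\<in>R. u' x > 0}"
      then show "x \<in> S - {s}"
        using out[of x] s by (cases "x \<in> S") (auto simp: u'_def)
    qed
    have lt: "card {x\<in>R. u' x > 0} < card S"
      using supp s(1) finS by (meson card_Diff1_less card_mono finite_Diff le_less_trans)
    have IH: "2 * c * d * (\<Sum>x\<in>R. u' x) \<le> (\<Sum>x\<in>R. \<Sum>y\<in>R. adj x y * \<bar>u' x - u' y\<bar>)"
      using lt less.prems(2) out m_le
      by (intro less.hyps) (auto simp: S_def[symmetric] u'_def of_bool_def intro: less.prems(1))
    let ?\<chi> = "\<lambda>x. of_bool (x \<in> S) :: real"
    \<comment> \<open>The two parts add without cancellation: \<open>u'\<close> is nonnegative on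
      \<open>S\<close> and zero off it, so across the boundary of \<open>S\<close> both differences
      have the same sign.\<close>
    have split: "\<bar>u x - u y\<bar> = \<bar>u' x - u' y\<bar> + m * \<bar>?\<chi> x - ?\<chi> y\<bar>" if "x \<in> R" "y \<in> R" for x y
      using that out[of x] out[of y] m_le[of x] m_le[of y] m_pos
      by (cases "x \<in> S"; cases "y \<in> S") (auto simp: u'_def)
    have cut: "2 * c * d * card S \<le> (\<Sum>x\<in>R. \<Sum>y\<in>R. adj x y * \<bar>?\<chi> x - ?\<chi> y\<bar>)"
    proof -
      have SR: "S \<subseteq> R" by (auto simp: S_def)
      have half: "(\<Sum>x\<in>R. \<Sum>y\<in>R. adj x y * (of_bool (x \<in> S) * of_bool (y \<notin> S))) = card (E \<inter> S \<times> (R - S))"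
      proof -
        have "(\<Sum>x\<in>R. \<Sum>y\<in>R. adj x y * (of_bool (x \<in> S) * of_bool (y \<notin> S)))
          = (\<Sum>x\<in>S. \<Sum>y\<in>R. adj x y * of_bool (y \<notin> S))"
          using SR finite_R by (intro sum.mono_neutral_cong_right) auto
        also have "\<dots> = (\<Sum>x\<in>S. \<Sum>y\<in>R - S. adj x y)"
          using finite_R by (intro sum.cong refl sum.mono_neutral_cong_right) auto
        also have "\<dots> = card (E \<inter> S \<times> (R - S))"
          using finite_R finS by (simp add: sum_adj card_edges_eq_sum del: sum_of_bool_eq)
        finally show ?thesis .
      qed
      have "(\<Sum>x\<in>R. \<Sum>y\<in>R. adj x y * \<bar>?\<chi> x - ?\<chi> y\<bar>)
        = (\<Sum>x\<in>R. \<Sum>y\<in>R. adj x y * (of_bool (x \<in> S) * of_bool (y \<notin> S)))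
          + (\<Sum>x\<in>R. \<Sum>y\<in>R. adj x y * (of_bool (y \<in> S) * of_bool (x \<notin> S)))"
        unfolding sum.distrib[symmetric] by (intro sum.cong refl) auto
      also have "\<dots> = 2 * card (E \<inter> S \<times> (R - S))"
        using half sum_adj_swap[of "\<lambda>x y. of_bool (x \<in> S) * of_bool (y \<notin> S)"] by simp
      finally show ?thesis
        using expansion[OF SR] less.prems(2) by (simp add: S_def)
    qed
    have "(\<Sum>x\<in>R. u x) = (\<Sum>x\<in>R. u' x + m * ?\<chi> x)"
      by (simp add: u'_def)
    also have "\<dots> = (\<Sum>x\<in>R. u' x) + m * card S"
    proof -
      have "(\<Sum>x\<in>R. ?\<chi> x) = (\<Sum>x\<in>S. 1)"
        using finite_R by (intro sum.mono_neutral_cong_right) (auto simp: S_def)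
      then show ?thesis
        by (simp add: sum.distrib sum_distrib_left[symmetric] del: sum_of_bool_eq sum_mult_of_bool_eq)
    qed
    finally have "2 * c * d * (\<Sum>x\<in>R. u x) = 2 * c * d * (\<Sum>x\<in>R. u' x) + m * (2 * c * d * card S)"
      by (simp add: algebra_simps)
    also have "\<dots> \<le> (\<Sum>x\<in>R. \<Sum>y\<in>R. adj x y * \<bar>u' x - u' y\<bar>)
        + m * (\<Sum>x\<in>R. \<Sum>y\<in>R. adj x y * \<bar>?\<chi> x - ?\<chi> y\<bar>)"
      using IH cut m_pos by (intro add_mono mult_left_mono) auto
    also have "\<dots> = (\<Sum>x\<in>R. \<Sum>y\<in>R. adj x y * (\<bar>u' x - u' y\<bar> + m * \<bar>?\<chi> x - ?\<chi> y\<bar>))"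
      by (simp add: sum_distrib_left sum.distrib[symmetric] algebra_simps del: sum_mult_of_bool_eq sum_of_bool_mult_eq)
    also have "\<dots> = (\<Sum>x\<in>R. \<Sum>y\<in>R. adj x y * \<bar>u x - u y\<bar>)"
      by (intro sum.cong refl) (simp only: split)
    finally show ?thesis .
  qed
qed

text \<open>Coarea is applied to the square of \<open>g\<close>. Factoring the differences of
  squares, Cauchy-Schwarz bounds (2 c d G)^2 by \<open>dirichlet g\<close> times the sum of (g x + g
  y)^2, which is at most 4 d G; then 4 d G cancels.\<close>

lemma dirichlet_ge_supported:
  assumes "\<And>x. x \<in> R \<Longrightarrow> 0 \<le> g x" "2 * card {x\<in>R. g x > 0} \<le> card R"
  shows "c\<^sup>2 * d * (\<Sum>x\<in>R. (g x)\<^sup>2) \<le> dirichlet g"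
proof -
  let ?G = "\<Sum>x\<in>R. (g x)\<^sup>2"
  \<comment> \<open>Double sums become sums over arcs, so that Cauchy-Schwarz acts on a single index
    set.\<close>
  define P where "P = E \<inter> R \<times> R"
  have to_pairs: "(\<Sum>x\<in>R. \<Sum>y\<in>R. adj x y * f x y) = (\<Sum>p\<in>P. f (fst p) (snd p))" for f :: "'a \<Rightarrow> 'a \<Rightarrow> real"
  proof -
    have "(\<Sum>x\<in>R. \<Sum>y\<in>R. adj x y * f x y) = (\<Sum>p\<in>R \<times> R. of_bool (p \<in> E) * f (fst p) (snd p))"
      by (simp add: sum.cartesian_product case_prod_beta del: sum_mult_of_bool_eq sum_of_bool_mult_eq)
    also have "\<dots> = (\<Sum>p\<in>P. f (fst p) (snd p))"
      unfolding P_def using finite_R by (intro sum.mono_neutral_cong_right) auto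
    finally show ?thesis .
  qed
  have pos: "{x\<in>R. (g x)\<^sup>2 > 0} = {x\<in>R. g x > 0}"
    using assms(1) by (auto simp: less_le)
  have G_nonneg: "0 \<le> ?G" by (simp add: sum_nonneg)
  have "2 * c * d * ?G \<le> (\<Sum>x\<in>R. \<Sum>y\<in>R. adj x y * \<bar>(g x)\<^sup>2 - (g y)\<^sup>2\<bar>)"
    using assms(2) by (intro coarea) (simp_all only: pos zero_le_power2)
  also have "\<dots> = (\<Sum>p\<in>P. \<bar>g (fst p) - g (snd p)\<bar> * \<bar>g (fst p) + g (snd p)\<bar>)"
    unfolding to_pairs by (intro sum.cong refl) (simp add: abs_mult[symmetric] power2_eq_square algebra_simps)
  finally have "2 * c * d * ?G \<le> \<dots>" .
  then have "(2 * c * d * ?G)\<^sup>2 \<le> (\<Sum>p\<in>P. \<bar>g (fst p) - g (snd p)\<bar> * \<bar>g (fst p) + g (snd p)\<bar>)\<^sup>2"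
    using G_nonneg c_pos d_pos by (intro power_mono) auto
  also have "\<dots> \<le> (\<Sum>p\<in>P. \<bar>g (fst p) - g (snd p)\<bar>\<^sup>2) * (\<Sum>p\<in>P. \<bar>g (fst p) + g (snd p)\<bar>\<^sup>2)"
    by (rule Cauchy_Schwarz_ineq_sum)
  also have "(\<Sum>p\<in>P. \<bar>g (fst p) - g (snd p)\<bar>\<^sup>2) = dirichlet g"
    by (simp add: dirichlet_def to_pairs)
  finally have cs: "(2 * c * d * ?G)\<^sup>2 \<le> dirichlet g * (\<Sum>p\<in>P. \<bar>g (fst p) + g (snd p)\<bar>\<^sup>2)" .
  have "(\<Sum>p\<in>P. \<bar>g (fst p) + g (snd p)\<bar>\<^sup>2) \<le> 4 * d * ?G"
  proof -
    have "(\<Sum>p\<in>P. \<bar>g (fst p) + g (snd p)\<bar>\<^sup>2) = (\<Sum>x\<in>R. \<Sum>y\<in>R. adj x y * (g x + g y)\<^sup>2)"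
      by (simp add: to_pairs)
    also have "\<dots> \<le> (\<Sum>x\<in>R. \<Sum>y\<in>R. adj x y * (2 * (g x)\<^sup>2) + adj x y * (2 * (g y)\<^sup>2))"
    proof (intro sum_mono)
      fix x y
      have "(g x + g y)\<^sup>2 \<le> 2 * (g x)\<^sup>2 + 2 * (g y)\<^sup>2"
        using sum_squares_bound[of "g x" "g y"] by (simp add: power2_sum)
      then show "adj x y * (g x + g y)\<^sup>2 \<le> adj x y * (2 * (g x)\<^sup>2) + adj x y * (2 * (g y)\<^sup>2)"
        by (cases "(x, y) \<in> E") auto
    qed
    also have "\<dots> = 2 * (\<Sum>x\<in>R. \<Sum>y\<in>R. adj x y * (2 * (g x)\<^sup>2))"
      using sum_adj_swap[of "\<lambda>x y. 2 * (g x)\<^sup>2"] by (simp only: sum.distrib)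
    also have "\<dots> = 2 * (\<Sum>x\<in>R. card (E `` {x} \<inter> R) * (2 * (g x)\<^sup>2))"
      by (simp only: sum_distrib_right[symmetric] sum_adj[OF order_refl])
    also have "\<dots> = 4 * (\<Sum>x\<in>R. card (E `` {x} \<inter> R) * (g x)\<^sup>2)"
      by (simp add: sum_distrib_left mult_ac)
    also have "\<dots> \<le> 4 * (\<Sum>x\<in>R. d * (g x)\<^sup>2)"
      using degree_le by (intro mult_left_mono sum_mono mult_right_mono) auto
    finally show ?thesis by (simp add: sum_distrib_left mult_ac)
  qed
  then have "(2 * c * d * ?G)\<^sup>2 \<le> dirichlet g * (4 * d * ?G)"
    using cs dirichlet_nonneg by (meson mult_left_mono order_trans)
  then have "(4 * d * ?G) * (c\<^sup>2 * d * ?G) \<le> (4 * d * ?G) * dirichlet g"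
    by (simp add: power2_eq_square mult_ac)
  then show ?thesis
    using G_nonneg d_pos dirichlet_nonneg[of g] by (cases "?G = 0") auto
qed

text \<open>Shift by a median and split into a positive part \<open>g\<close> and a negative part
  \<open>h\<close>, each supported on at most half of \<open>R\<close>. Their two bounds add up
  because the splitting does not raise the Dirichlet form.\<close>

lemma cheeger_inequality:
  "c\<^sup>2 * d * ((\<Sum>x\<in>R. (f x)\<^sup>2) - (\<Sum>x\<in>R. f x)\<^sup>2 / card R) \<le> dirichlet f"
proof -
  obtain m where m: "2 * card {x\<in>R. f x > m} \<le> card R" "2 * card {x\<in>R. f x < m} \<le> card R"
    using median_exists[OF finite_R R_nonempty] by blast
  define g where "g x = max (f x - m) 0" for x
  define h where "h x = max (m - f x) 0" for x
  have gh: "{x\<in>R. g x > 0} = {x\<in>R. f x > m}" "{x\<in>R. h x > 0} = {x\<in>R. f x < m}"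
    by (auto simp: g_def h_def)
  have N: "card R > 0" using card_R by simp
  let ?N = "real (card R)" and ?S = "\<Sum>x\<in>R. f x"
  \<comment> \<open>The mean minimises the sum of squared deviations, so replacing it by the median
    can only increase that sum.\<close>
  have "(\<Sum>x\<in>R. (f x)\<^sup>2) - ?S\<^sup>2 / ?N \<le> (\<Sum>x\<in>R. (f x)\<^sup>2) - ?S\<^sup>2 / ?N + (?S - ?N * m)\<^sup>2 / ?N"
    by simp
  also have "\<dots> = (\<Sum>x\<in>R. (f x)\<^sup>2) - 2 * m * ?S + ?N * m\<^sup>2"
  proof -
    have "(?S - ?N * m)\<^sup>2 / ?N = ?S\<^sup>2 / ?N - 2 * m * ?S + ?N * m\<^sup>2"
      using N by (simp add: power2_diff field_simps power2_eq_square)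
    then show ?thesis by linarith
  qed
  also have "\<dots> = (\<Sum>x\<in>R. (f x)\<^sup>2 - 2 * m * f x + m\<^sup>2)"
    by (simp add: sum.distrib sum_subtractf sum_distrib_left)
  also have "\<dots> = (\<Sum>x\<in>R. (g x)\<^sup>2 + (h x)\<^sup>2)"
    by (intro sum.cong refl) (auto simp: g_def h_def max_def power2_eq_square algebra_simps)
  finally have "(\<Sum>x\<in>R. (f x)\<^sup>2) - ?S\<^sup>2 / ?N \<le> (\<Sum>x\<in>R. (g x)\<^sup>2) + (\<Sum>x\<in>R. (h x)\<^sup>2)"
    by (simp add: sum.distrib)
  then have "c\<^sup>2 * d * ((\<Sum>x\<in>R. (f x)\<^sup>2) - ?S\<^sup>2 / ?N)
      \<le> c\<^sup>2 * d * ((\<Sum>x\<in>R. (g x)\<^sup>2) + (\<Sum>x\<in>R. (h x)\<^sup>2))"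
    using d_pos by (intro mult_left_mono) auto
  also have "\<dots> \<le> dirichlet g + dirichlet h"
    using dirichlet_ge_supported[of g] dirichlet_ge_supported[of h] m
    by (simp add: gh distrib_left) (simp add: g_def h_def)
  also have "\<dots> \<le> dirichlet f"
    unfolding dirichlet_def sum.distrib[symmetric] distrib_left[symmetric]
  proof (intro sum_mono mult_left_mono)
    fix x y
    \<comment> \<open>\<open>g\<close> rises and \<open>h\<close> falls with \<open>f\<close>, so
      their differences never have the same sign.\<close>
    have "(g x - g y) * (h x - h y) \<le> 0"
      by (auto simp: g_def h_def max_def mult_le_0_iff)
    moreover have f_eq: "f x - f y = (g x - g y) - (h x - h y)"
      by (auto simp: g_def h_def max_def)
    have "(f x - f y)\<^sup>2 = (g x - g y)\<^sup>2 + (h x - h y)\<^sup>2 - 2 * ((g x - g y) * (h x - h y))"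
      by (simp only: f_eq power2_diff[of "g x - g y"] mult.assoc)
    ultimately show "(g x - g y)\<^sup>2 + (h x - h y)\<^sup>2 \<le> (f x - f y)\<^sup>2"
      by linarith
  qed auto
  finally show ?thesis .
qed

text \<open>Each edge gets probability 1 / (2 d) whatever the degrees of its ends, which keeps the
  kernel symmetric. The holding probability is at least 1/2 on \<open>R\<close>, which excludes
  eigenvalues near -1.\<close>

definition lazy_walk :: "'a \<Rightarrow> 'a \<Rightarrow> real" where
  "lazy_walk x y = adj x y / (2 * d)
    + (if x = y then 1 - real (card (E `` {x} \<inter> R)) / (2 * d) else 0)"

lemma lazy_walk_step:
  assumes "x \<in> R"
  shows "(\<Sum>y\<in>R. lazy_walk x y * f y) = f x - (\<Sum>y\<in>R. adj x y * (f x - f y)) / (2 * d)"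
proof -
  have "(\<Sum>y\<in>R. lazy_walk x y * f y)
    = (\<Sum>y\<in>R. adj x y * f y) / (2 * d) + (1 - real (card (E `` {x} \<inter> R)) / (2 * d)) * f x"
    using assms finite_R
    by (simp add: lazy_walk_def distrib_right sum.distrib sum_divide_distrib if_distrib[of "\<lambda>t. t * _"]
        cong: if_cong del: sum_mult_of_bool_eq sum_of_bool_mult_eq)
  moreover have "(\<Sum>y\<in>R. adj x y * (f x - f y)) = card (E `` {x} \<inter> R) * f x - (\<Sum>y\<in>R. adj x y * f y)"
    by (simp add: right_diff_distrib sum_subtractf sum_distrib_right[symmetric] sum_adj
        del: sum_mult_of_bool_eq sum_of_bool_mult_eq)
  ultimately show ?thesis
    using d_pos by (simp only:) (simp add: field_simps)
qed

text \<open>With \<open>?h\<close> the Laplacian of \<open>f\<close>, a step is f - ?h / (2 d). The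
  inner product of \<open>f\<close> and \<open>?h\<close> is half the Dirichlet form D, and the
  squared norm of \<open>?h\<close> is at most d D, so the squared norm of \<open>f\<close> drops by
  at least D / (2 d) - D / (4 d) = D / (4 d). Cheeger's inequality turns this into \<gamma> = c^2 /
  4.\<close>

lemma lazy_walk_mixing: "mixing_kernel R lazy_walk (c\<^sup>2 / 4)"
proof
  show "finite R" "R \<noteq> {}" using finite_R R_nonempty by auto
  show "0 < c\<^sup>2 / 4" using c_pos by simp
  show "c\<^sup>2 / 4 \<le> 1" using c_pos c_le_1 power_le_one[of c 2] by simp
  show "lazy_walk x y = lazy_walk y x" for x y
    using adj_sym[of x y] by (auto simp: lazy_walk_def)
  show "0 \<le> lazy_walk x y" if "x \<in> R" for x y
    using degree_le[OF that] d_pos by (auto simp: lazy_walk_def)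
  show "(\<Sum>y\<in>R. lazy_walk x y) = 1" if "x \<in> R" for x
    using lazy_walk_step[OF that, of "\<lambda>_. 1"] by simp
  fix f :: "'a \<Rightarrow> real"
  let ?h = "\<lambda>x. \<Sum>y\<in>R. adj x y * (f x - f y)"
  have "(\<Sum>x\<in>R. (\<Sum>y\<in>R. lazy_walk x y * f y)\<^sup>2)
    = (\<Sum>x\<in>R. (f x)\<^sup>2 - f x * ?h x / d + (?h x)\<^sup>2 / (4 * d\<^sup>2))"
    using d_pos by (intro sum.cong refl) (simp add: lazy_walk_step power2_diff power_divide power_mult_distrib)
  then have expand: "(\<Sum>x\<in>R. (\<Sum>y\<in>R. lazy_walk x y * f y)\<^sup>2)
    = (\<Sum>x\<in>R. (f x)\<^sup>2) - (\<Sum>x\<in>R. f x * ?h x) / d + (\<Sum>x\<in>R. (?h x)\<^sup>2) / (4 * d\<^sup>2)"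
    by (simp only: sum.distrib sum_subtractf sum_divide_distrib)
  have cross: "(\<Sum>x\<in>R. f x * ?h x) = dirichlet f / 2"
  proof -
    let ?T = "\<Sum>x\<in>R. \<Sum>y\<in>R. adj x y * (f x * (f x - f y))"
    have "dirichlet f = (\<Sum>x\<in>R. \<Sum>y\<in>R. adj x y * (f x * (f x - f y)) + adj x y * (f y * (f y - f x)))"
      unfolding dirichlet_def by (intro sum.cong refl) (simp add: power2_eq_square algebra_simps)
    also have "\<dots> = 2 * ?T"
      using sum_adj_swap[of "\<lambda>x y. f x * (f x - f y)"] by (simp only: sum.distrib)
    also have "?T = (\<Sum>x\<in>R. f x * ?h x)"
      by (simp only: sum_distrib_left mult.left_commute)
    finally show ?thesis by linarith
  qed
  have "(?h x)\<^sup>2 \<le> d * (\<Sum>y\<in>R. adj x y * (f x - f y)\<^sup>2)" if "x \<in> R" for x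
  proof -
    have "?h x = (\<Sum>y\<in>R. adj x y * (adj x y * (f x - f y)))"
      by (intro sum.cong) auto
    then have "(?h x)\<^sup>2 \<le> (\<Sum>y\<in>R. (adj x y)\<^sup>2) * (\<Sum>y\<in>R. (adj x y * (f x - f y))\<^sup>2)"
      by (simp only: Cauchy_Schwarz_ineq_sum)
    moreover have "(\<Sum>y\<in>R. (adj x y)\<^sup>2) = (\<Sum>y\<in>R. adj x y)"
      by (intro sum.cong) auto
    moreover have "(\<Sum>y\<in>R. (adj x y * (f x - f y))\<^sup>2) = (\<Sum>y\<in>R. adj x y * (f x - f y)\<^sup>2)"
      by (intro sum.cong) auto
    moreover have "(\<Sum>y\<in>R. adj x y) * (\<Sum>y\<in>R. adj x y * (f x - f y)\<^sup>2)
        \<le> d * (\<Sum>y\<in>R. adj x y * (f x - f y)\<^sup>2)"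
      using degree_le[OF that] unfolding sum_adj[OF order_refl]
      by (intro mult_right_mono sum_nonneg) auto
    ultimately show ?thesis by (simp only:)
  qed
  then have "(\<Sum>x\<in>R. (?h x)\<^sup>2) \<le> d * dirichlet f"
    unfolding dirichlet_def sum_distrib_left[of d] by (rule sum_mono)
  then have "(\<Sum>x\<in>R. (?h x)\<^sup>2) / (4 * d\<^sup>2) \<le> d * dirichlet f / (4 * d\<^sup>2)"
    by (rule divide_right_mono) simp
  also have "\<dots> = dirichlet f / (4 * d)"
    using d_pos by (simp add: power2_eq_square)
  finally have "(\<Sum>x\<in>R. (\<Sum>y\<in>R. lazy_walk x y * f y)\<^sup>2)
      \<le> (\<Sum>x\<in>R. (f x)\<^sup>2) - dirichlet f / 2 / d + dirichlet f / (4 * d)"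
    unfolding expand cross by linarith
  also have "\<dots> = (\<Sum>x\<in>R. (f x)\<^sup>2) - dirichlet f / (4 * d)"
    using d_pos by (simp add: field_simps)
  also have "\<dots> \<le> (\<Sum>x\<in>R. (f x)\<^sup>2) - c\<^sup>2 / 4 * ((\<Sum>x\<in>R. (f x)\<^sup>2) - (\<Sum>x\<in>R. f x)\<^sup>2 / card R)"
  proof -
    have "c\<^sup>2 / 4 * ((\<Sum>x\<in>R. (f x)\<^sup>2) - (\<Sum>x\<in>R. f x)\<^sup>2 / card R) \<le> dirichlet f / (4 * d)"
      using cheeger_inequality[of f] d_pos by (simp add: pos_le_divide_eq mult_ac)
    then show ?thesis by linarith
  qed
  finally show "(\<Sum>x\<in>R. (\<Sum>y\<in>R. lazy_walk x y * f y)\<^sup>2)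
    \<le> (\<Sum>x\<in>R. (f x)\<^sup>2) - c\<^sup>2 / 4 * ((\<Sum>x\<in>R. (f x)\<^sup>2) - (\<Sum>x\<in>R. f x)\<^sup>2 / card R)" .
qed

lemma lazy_walk_pos: "lazy_walk x y > 0 \<Longrightarrow> x = y \<or> (x, y) \<in> E"
  by (auto simp: lazy_walk_def of_bool_def split: if_splits)

end

subsection \<open>Distance from a random walk to a set\<close>

context expander
begin

text \<open>The growth is geometric, but the bound enters an exponent, where growth linear in
  \<open>r\<close> already yields a geometric series.\<close>

lemma nball_card_grow:
  assumes "A \<subseteq> R" "2 * card (nball E R A r) \<le> card R"
  shows "(1 + c * r) * real (card A) \<le> real (card (nball E R A r))"
  using assms(2)
proof (induction r)
  case (Suc r)
  let ?B = "nball E R A r"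
  have sub: "?B \<subseteq> R" "nball E R A (Suc r) \<subseteq> R"
    using nball_subset[OF assms(1)] by auto
  have "card ?B \<le> card (nball E R A (Suc r))"
    using nball_mono[of r "Suc r" E R A] sub finite_R by (intro card_mono) (auto intro: finite_subset simp del: nball.simps)
  then have half: "2 * card ?B \<le> card R" using Suc.prems by linarith
  have "(1 + c * Suc r) * real (card A) \<le> (1 + c) * ((1 + c * r) * real (card A))"
    using c_pos by (simp add: algebra_simps)
  also have "\<dots> \<le> (1 + c) * real (card ?B)"
    using Suc.IH[OF half] c_pos by (intro mult_left_mono) auto
  also have "\<dots> \<le> real (card (nball E R A (Suc r)))"
    using nball_grow[OF sub(1) half] by simp
  finally show ?case .
qed simp

text \<open>The sum is the expected distance from the walk to \<open>A\<close>, cut off at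
  \<open>M\<close>: the distance exceeds \<open>r\<close> iff the walk avoids the ball of radius
  \<open>r\<close>. While the ball is below half of \<open>R\<close>, the exponent at radius
  \<open>r\<close> is at least y + c y r >= y + r. Afterwards it is at least c^2 l / 16, and the
  leading factors \<open>z r\<close> decay geometrically, with sum at most 2 / c.\<close>

lemma sum_walk_avoid_nball:
  fixes l :: nat
  assumes "A \<subseteq> R"
  defines "y \<equiv> c\<^sup>2 / 8 * (real (card A) / card R) * l"
  assumes "1 \<le> c * y"
  shows "(\<Sum>r<M. mixing_kernel.walk_mean R lazy_walk l (\<lambda>ws. of_bool (set ws \<subseteq> R - nball E R A r)))
    \<le> 2 * exp (- y) + 2 / c * exp (- (c\<^sup>2 * l / 16))"
proof -
  interpret mixing_kernel R lazy_walk "c\<^sup>2 / 4" by (rule lazy_walk_mixing)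
  define z where "z r = real (card (R - nball E R A r)) / card R" for r
  \<comment> \<open>Keeps only the radii of the second regime, where the complement of the ball is
    at most half of \<open>R\<close>.\<close>
  define z' where "z' r = (if 2 * card (R - nball E R A r) \<le> card R then z r else 0)" for r
  let ?P = "\<lambda>r. walk_mean l (\<lambda>ws. of_bool (set ws \<subseteq> R - nball E R A r))"
  have sub: "nball E R A r \<subseteq> R" for r
    using nball_subset[OF assms(1)] .
  have card_compl: "card (R - nball E R A r) = card R - card (nball E R A r)"
      "card (nball E R A r) \<le> card R" for r
    using card_Diff_subset[OF finite_subset[OF sub finite_R] sub] card_mono[OF finite_R sub] by auto
  have z1: "1 - z r = real (card (nball E R A r)) / card R" for r
    using card_compl[of r] card_R_pos by (simp add: z_def of_nat_diff field_simps)
  have z01: "0 \<le> z r" "z r \<le> 1" for r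
    using card_compl[of r] card_R_pos by (auto simp: z_def)
  have P_le: "?P r \<le> z r * exp (- (c\<^sup>2 / 4) * (1 - z r) * l / 2)" for r
    using walk_avoid_exp_le[of "R - nball E R A r" l] by (simp add: z_def)
  have bound: "?P r \<le> exp (- y) * (1 / 2) ^ r + exp (- (c\<^sup>2 * l / 16)) * z' r" for r
  proof (cases "2 * card (R - nball E R A r) \<le> card R")
    case True
    then have "2 * real (card (R - nball E R A r)) \<le> real (card R)"
      by linarith
    then have "z r \<le> 1 / 2"
      using card_R_pos by (simp add: z_def)
    then have "c\<^sup>2 / 8 * l * (1 / 2) \<le> c\<^sup>2 / 8 * l * (1 - z r)"
      by (intro mult_left_mono) auto
    then have "exp (- (c\<^sup>2 / 4) * (1 - z r) * l / 2) \<le> exp (- (c\<^sup>2 * l / 16))"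
      by (simp add: field_simps)
    then have "?P r \<le> z r * exp (- (c\<^sup>2 * l / 16))"
      using P_le[of r] z01(1)[of r] by (meson mult_left_mono order_trans)
    then show ?thesis
      using True by (simp add: z'_def mult.commute add_increasing)
  next
    case False
    then have "2 * card (nball E R A r) \<le> card R"
      using card_compl[of r] by linarith
    from nball_card_grow[OF assms(1) this]
    have "(1 + c * r) * (real (card A) / card R) \<le> 1 - z r"
      unfolding z1 using card_R_pos by (simp add: divide_right_mono)
    then have "c\<^sup>2 / 8 * l * ((1 + c * r) * (real (card A) / card R)) \<le> c\<^sup>2 / 8 * l * (1 - z r)"
      by (intro mult_left_mono) auto
    moreover have "c\<^sup>2 / 8 * l * ((1 + c * r) * a) = c\<^sup>2 / 8 * a * l + c * (c\<^sup>2 / 8 * a * l) * r" for a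
      by (simp add: algebra_simps)
    ultimately have "y + c * y * r \<le> c\<^sup>2 / 8 * l * (1 - z r)"
      by (simp only: y_def)
    moreover have "1 * real r \<le> c * y * r"
      using assms(3) by (intro mult_right_mono) auto
    ultimately have "- (c\<^sup>2 / 4) * (1 - z r) * l / 2 \<le> - y + real r * (- 1)"
      by (simp add: field_simps)
    then have "exp (- (c\<^sup>2 / 4) * (1 - z r) * l / 2) \<le> exp (- y) * exp (- 1) ^ r"
      by (simp only: exp_of_nat_mult[symmetric] mult_exp_exp exp_le_cancel_iff)
    also have "\<dots> \<le> exp (- y) * (1 / 2) ^ r"
    proof -
      have "2 \<le> exp (1::real)" using exp_ge_add_one_self[of 1] by simp
      then have "exp (- 1) \<le> (1 / 2 :: real)" by (simp add: exp_minus field_simps)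
      then show ?thesis by (intro mult_left_mono power_mono) auto
    qed
    finally have "z r * exp (- (c\<^sup>2 / 4) * (1 - z r) * l / 2) \<le> 1 * (exp (- y) * (1 / 2) ^ r)"
      using z01[of r] by (intro mult_mono) auto
    then show ?thesis
      using P_le[of r] False by (simp add: z'_def)
  qed
  \<comment> \<open>Telescoping: in the second regime c z (r + 1) <= z r - z (r + 1).\<close>
  have "c * (\<Sum>r<M. z' (Suc r)) + z M \<le> z 0" for M
  proof (induction M)
    case (Suc M)
    have "c * z' (Suc M) + z (Suc M) \<le> z M"
    proof (cases "2 * card (R - nball E R A (Suc M)) \<le> card R")
      case True
      then have "(1 + c) * real (card (R - nball E R A (Suc M))) \<le> real (card (R - nball E R A M))"
        using nball_compl_shrink[OF sub[of M]] by simp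
      then have "(1 + c) * z (Suc M) \<le> z M"
        using card_R_pos by (simp add: z_def divide_right_mono)
      then show ?thesis
        using True by (simp add: z'_def algebra_simps del: nball.simps)
    next
      case False
      have "card (R - nball E R A (Suc M)) \<le> card (R - nball E R A M)"
        using finite_R by (intro card_mono) auto
      then show ?thesis
        using False by (auto simp: z'_def z_def divide_right_mono simp del: nball.simps)
    qed
    then show ?case using Suc.IH by (simp add: distrib_left)
  qed simp
  from this[of M] have le_1: "c * (\<Sum>r<M. z' (Suc r)) \<le> 1"
    using z01(1)[of M] z01(2)[of 0] by linarith
  have z'01: "0 \<le> z' r" "z' r \<le> 1" for r
    using z01 by (auto simp: z'_def)
  have "(\<Sum>r<M. z' r) \<le> z' 0 + (\<Sum>r<M. z' (Suc r))"
    using z'01(1)[of M] sum.lessThan_Suc_shift[of z' M] by simp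
  then have "c * (\<Sum>r<M. z' r) \<le> c * z' 0 + c * (\<Sum>r<M. z' (Suc r))"
    using c_pos by (simp only: distrib_left[symmetric] mult_le_cancel_left_pos)
  also have "\<dots> \<le> c * 1 + 1"
    using le_1 z'01(2)[of 0] c_pos by (intro add_mono mult_left_mono) auto
  finally have "c * (\<Sum>r<M. z' r) \<le> c * 1 + 1" .
  then have z'_sum: "(\<Sum>r<M. z' r) \<le> 2 / c"
    using c_pos c_le_1 by (simp add: field_simps)
  have "(\<Sum>r<M. ?P r) \<le> (\<Sum>r<M. exp (- y) * (1 / 2) ^ r + exp (- (c\<^sup>2 * l / 16)) * z' r)"
    by (intro sum_mono bound)
  also have "\<dots> = exp (- y) * (\<Sum>r<M. (1 / 2) ^ r) + exp (- (c\<^sup>2 * l / 16)) * (\<Sum>r<M. z' r)"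
    by (simp only: sum.distrib sum_distrib_left)
  also have "\<dots> \<le> exp (- y) * 2 + exp (- (c\<^sup>2 * l / 16)) * (2 / c)"
  proof -
    have "(\<Sum>r<M. (1 / 2 :: real) ^ r) \<le> 2"
      by (simp add: sum_gp_strict)
    then show ?thesis using z'_sum by (intro add_mono mult_left_mono) auto
  qed
  finally show ?thesis by (simp add: mult.commute)
qed

end

subsection \<open>Branch sets from random walks\<close>

text \<open>With d l <= 4 |R| the second moment for one neighbourhood is at most 2 l d (17 + 2 / (1
  - sqrt (1 - c^2 / 4))) / |R|, where 17 = 1 + 2 * 8 and c^2 / 4 is the gap of the lazy walk. A
  further factor 2 is reserve for Markov's inequality.\<close>

definition visits_const :: "real \<Rightarrow> real" where
  "visits_const c = 4 * (17 + 2 / (1 - sqrt (1 - c\<^sup>2 / 4)))"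

text \<open>Chosen so that twice this constant is c * c^2 / \<open>visits_const c\<close>: the edges
  from the walk and those from the detours, each at most \<open>detour_const c * d * l\<close>,
  together stay below c d |W|.\<close>

definition detour_const :: "real \<Rightarrow> real" where
  "detour_const c = c ^ 3 / (2 * visits_const c)"

text \<open>Makes \<open>hit_const c * visits_const c\<close> the square of
  \<open>detour_const c\<close>, as Cauchy-Schwarz needs in \<open>walk_edges_le\<close>.\<close>

definition hit_const :: "real \<Rightarrow> real" where
  "hit_const c = (detour_const c)\<^sup>2 / visits_const c"

lemma visits_const_ge:
  assumes "0 < c" "c \<le> 1"
  shows "68 \<le> visits_const c"
proof -
  have "sqrt (1 - c\<^sup>2 / 4) < 1" using assms by simp
  then show ?thesis by (simp add: visits_const_def)
qed

lemma detour_const_bounds: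
  assumes "0 < c" "c \<le> 1"
  shows "0 < detour_const c" "detour_const c \<le> 1"
proof -
  have "c ^ 3 \<le> 1" using assms by (simp add: power_le_one)
  with visits_const_ge[OF assms] assms(1) show "0 < detour_const c" "detour_const c \<le> 1"
    by (auto simp: detour_const_def field_simps)
qed

lemma hit_const_pos:
  assumes "0 < c" "c \<le> 1"
  shows "0 < hit_const c"
  using detour_const_bounds[OF assms] visits_const_ge[OF assms] by (simp add: hit_const_def)

lemma visits_ge_card: "finite B \<Longrightarrow> real (card (B \<inter> set ws)) \<le> visits B ws"
proof (induction ws)
  case (Cons w ws)
  have "card (B \<inter> set (w # ws)) \<le> card ((if w \<in> B then {w} else {}) \<union> (B \<inter> set ws))"
    using Cons.prems by (intro card_mono) auto
  also have "\<dots> \<le> card (if w \<in> B then {w} else {}) + card (B \<inter> set ws)"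
    by (rule card_Un_le)
  finally show ?case
    using Cons by (auto simp: visits_def indicator_def split: if_splits)
qed (simp add: visits_def)

lemma visits_eq_0: "B \<inter> set ws = {} \<Longrightarrow> visits B ws = 0"
  by (induction ws) (auto simp: visits_def)

context expander
begin

lemma sum_visits_nbrs:
  assumes "set ws \<subseteq> R"
  shows "(\<Sum>v\<in>R. visits (E `` {v} \<inter> R) ws) = (\<Sum>w\<leftarrow>ws. real (card (E `` {w} \<inter> R)))"
  using assms
proof (induction ws)
  case (Cons w ws)
  have "(\<Sum>v\<in>R. indicator (E `` {v} \<inter> R) w :: real) = (\<Sum>v\<in>R. adj w v)"
    using Cons.prems sym_E by (intro sum.cong) (auto simp: indicator_def dest: symD)
  then show ?case
    using Cons by (simp add: visits_def sum.distrib sum_adj del: sum_of_bool_eq)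
qed (simp add: visits_def)

text \<open>The second moment bound says that few vertices of \<open>R\<close> see many vertices of the walk. Hence
  the walk cannot send most of its edges into a small set.\<close>

lemma sum_visits_sq:
  fixes l :: nat
  assumes "1 \<le> l" "d * l \<le> 4 * card R"
  shows "mixing_kernel.walk_mean R lazy_walk l (\<lambda>ws. \<Sum>v\<in>R. (visits (E `` {v} \<inter> R) ws)\<^sup>2)
    \<le> visits_const c * d * l / 2"
proof -
  interpret mixing_kernel R lazy_walk "c\<^sup>2 / 4" by (rule lazy_walk_mixing)
  define \<sigma> where "\<sigma> = sqrt (1 - c\<^sup>2 / 4)"
  have \<sigma>: "\<sigma> < 1" using c_pos by (simp add: \<sigma>_def)
  have l: "real l + 1 \<le> 2 * l" using assms(1) by simp
  let ?B = "\<lambda>v. E `` {v} \<inter> R"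
  have "walk_mean l (\<lambda>ws. (visits (?B v) ws)\<^sup>2)
      \<le> (2 * l) * (d + 2 * (8 * d + d / (1 - \<sigma>))) / card R" if v: "v \<in> R" for v
  proof -
    have B: "real (card (?B v)) \<le> d" using degree_le[OF v] .
    have "(real l + 1) * (real (card (?B v)))\<^sup>2 / card R \<le> (2 * l) * d\<^sup>2 / card R"
      using B l by (intro divide_right_mono mult_mono power_mono) auto
    also have "\<dots> = 2 * d * (d * l / card R)"
      by (simp add: power2_eq_square)
    also have "\<dots> \<le> 2 * d * 4"
      using assms(2) card_R_pos d_pos by (intro mult_left_mono) (auto simp: field_simps)
    finally have "(real l + 1) * (real (card (?B v)))\<^sup>2 / card R \<le> 8 * d" by simp
    moreover have "real (card (?B v)) / (1 - \<sigma>) \<le> d / (1 - \<sigma>)"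
      using B \<sigma> by (intro divide_right_mono) auto
    ultimately have "card (?B v) + 2 * ((real l + 1) * (real (card (?B v)))\<^sup>2 / card R + card (?B v) / (1 - \<sigma>))
        \<le> d + 2 * (8 * d + d / (1 - \<sigma>))"
      using B by simp
    then have "(real l + 1) * (card (?B v) + 2 * ((real l + 1) * (real (card (?B v)))\<^sup>2 / card R + card (?B v) / (1 - \<sigma>)))
        \<le> (2 * l) * (d + 2 * (8 * d + d / (1 - \<sigma>)))"
      using l \<sigma> by (intro mult_mono) auto
    moreover have "(\<Sum>x\<in>R. walk_exp l x (\<lambda>ws. (visits (?B v) ws)\<^sup>2))
        \<le> (real l + 1) * (card (?B v) + 2 * ((real l + 1) * (real (card (?B v)))\<^sup>2 / card R + card (?B v) / (1 - \<sigma>)))"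
      using sum_walk_exp_visits_sq[of "?B v" l] by (simp add: \<sigma>_def add.commute)
    ultimately show ?thesis
      unfolding walk_mean_def by (intro divide_right_mono) auto
  qed
  then have "(\<Sum>v\<in>R. walk_mean l (\<lambda>ws. (visits (?B v) ws)\<^sup>2))
      \<le> (\<Sum>v\<in>R. (2 * l) * (d + 2 * (8 * d + d / (1 - \<sigma>))) / card R)"
    by (rule sum_mono)
  also have "\<dots> = (2 * l) * (d + 2 * (8 * d + d / (1 - \<sigma>)))"
    using card_R_pos by simp
  also have "\<dots> = visits_const c * d * l / 2"
    by (simp add: visits_const_def \<sigma>_def[symmetric] algebra_simps)
  finally show ?thesis
    using finite_R by (simp add: walk_mean_sum)
qed

text \<open>The walk sends at least c d l edges, counted with multiplicity, to at most d |set ws|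
  neighbours. By Cauchy-Schwarz and the second moment bound the number of distinct states is then a
  positive fraction of \<open>l\<close>.\<close>

lemma walk_image_large:
  fixes l :: nat
  assumes "1 \<le> l" "set ws \<subseteq> R" "length ws = l + 1"
    and S2: "(\<Sum>v\<in>R. (visits (E `` {v} \<inter> R) ws)\<^sup>2) \<le> visits_const c * d * l"
  shows "c\<^sup>2 * l \<le> visits_const c * card (set ws)"
proof -
  let ?v = "\<lambda>v. visits (E `` {v} \<inter> R) ws"
  let ?N = "E `` set ws \<inter> R"
  have "c * d * l \<le> (\<Sum>w\<leftarrow>ws. c * d)"
    using assms(3) c_pos d_pos by (simp add: sum_list_triv algebra_simps)
  also have "\<dots> \<le> (\<Sum>w\<leftarrow>ws. real (card (E `` {w} \<inter> R)))"
    using assms(2) degree_ge by (intro sum_list_mono) auto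
  also have "\<dots> = (\<Sum>v\<in>R. ?v v)"
    using sum_visits_nbrs[OF assms(2)] by simp
  also have "\<dots> = (\<Sum>v\<in>?N. ?v v)"
    using finite_R sym_E by (intro sum.mono_neutral_right) (auto intro!: visits_eq_0 dest: symD)
  finally have "(c * d * l)\<^sup>2 \<le> (\<Sum>v\<in>?N. 1 * ?v v)\<^sup>2"
    using c_pos d_pos by (intro power_mono) auto
  also have "\<dots> \<le> (\<Sum>v\<in>?N. 1\<^sup>2) * (\<Sum>v\<in>?N. (?v v)\<^sup>2)"
    by (rule Cauchy_Schwarz_ineq_sum)
  also have "\<dots> \<le> (d * card (set ws)) * (visits_const c * d * l)"
  proof (rule mult_mono)
    have "card ?N \<le> card (E \<inter> set ws \<times> R)"
      using finite_R by (intro surj_card_le[where f = snd] finite_Int disjI2) force+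
    then show "(\<Sum>v\<in>?N. 1\<^sup>2) \<le> d * card (set ws)"
      using edges_le_left[OF assms(2) order_refl] by simp
    show "(\<Sum>v\<in>?N. (?v v)\<^sup>2) \<le> visits_const c * d * l"
      using finite_R by (intro order_trans[OF sum_mono2 S2]) auto
  qed (use d_pos in \<open>auto intro: sum_nonneg\<close>)
  finally have "(d\<^sup>2 * l) * (c\<^sup>2 * l) \<le> (d\<^sup>2 * l) * (visits_const c * card (set ws))"
    by (simp add: power2_eq_square mult_ac)
  then show ?thesis
    using d_pos assms(1) by simp
qed

text \<open>The edges into \<open>R'\<close> end in few vertices, so Cauchy-Schwarz against the
  second moment bounds their number. Conversely, many edges into \<open>R'\<close> mean many
  neighbours there.\<close>

lemma walk_edges_le:
  fixes l :: nat
  assumes "set ws \<subseteq> R" "R' \<subseteq> R"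
    and S2: "(\<Sum>v\<in>R. (visits (E `` {v} \<inter> R) ws)\<^sup>2) \<le> visits_const c * d * l"
    and few: "card (E `` set ws \<inter> R') \<le> hit_const c * d * l"
  shows "card (E \<inter> set ws \<times> R') \<le> detour_const c * d * l"
proof -
  let ?v = "\<lambda>v. visits (E `` {v} \<inter> R) ws"
  let ?B = "E `` set ws \<inter> R'"
  have K: "visits_const c > 0" "detour_const c > 0"
    using visits_const_ge[OF c_pos c_le_1] detour_const_bounds[OF c_pos c_le_1] by auto
  have fin: "finite R'" using assms(2) finite_R by (rule finite_subset)
  have "card (E \<inter> set ws \<times> R') = card (E \<inter> set ws \<times> ?B)"
    by (rule arg_cong[where f = card]) auto
  also have "\<dots> = card (E \<inter> ?B \<times> set ws)"
    by (rule card_edges_sym[OF sym_E])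
  also have "\<dots> = (\<Sum>v\<in>?B. card (E `` {v} \<inter> set ws))"
    using fin by (simp add: card_edges_eq_sum)
  finally have "real (card (E \<inter> set ws \<times> R')) = (\<Sum>v\<in>?B. real (card (E `` {v} \<inter> set ws)))"
    by simp
  also have "\<dots> \<le> (\<Sum>v\<in>?B. ?v v)"
  proof (rule sum_mono)
    fix v
    have "E `` {v} \<inter> set ws = (E `` {v} \<inter> R) \<inter> set ws" using assms(1) by auto
    then show "real (card (E `` {v} \<inter> set ws)) \<le> ?v v"
      using visits_ge_card[of "E `` {v} \<inter> R" ws] finite_R by simp
  qed
  finally have "(card (E \<inter> set ws \<times> R'))\<^sup>2 \<le> (\<Sum>v\<in>?B. 1 * ?v v)\<^sup>2"
    by (simp add: power_mono)
  also have "\<dots> \<le> (\<Sum>v\<in>?B. 1\<^sup>2) * (\<Sum>v\<in>?B. (?v v)\<^sup>2)"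
    by (rule Cauchy_Schwarz_ineq_sum)
  also have "\<dots> \<le> (hit_const c * d * l) * (visits_const c * d * l)"
  proof (rule mult_mono)
    show "(\<Sum>v\<in>?B. (?v v)\<^sup>2) \<le> visits_const c * d * l"
      using finite_R assms(2) by (intro order_trans[OF sum_mono2 S2]) auto
  qed (use few d_pos hit_const_pos[OF c_pos c_le_1] in \<open>auto intro: sum_nonneg\<close>)
  finally have le: "(card (E \<inter> set ws \<times> R'))\<^sup>2 \<le> (hit_const c * d * l) * (visits_const c * d * l)"
    by simp
  have eq: "(hit_const c * d * l) * (visits_const c * d * l) = (detour_const c * d * l)\<^sup>2"
    using K by (simp add: hit_const_def power2_eq_square)
  show ?thesis
    using power2_le_imp_le[of "real (card (E \<inter> set ws \<times> R'))" "detour_const c * d * l"] le eq K d_pos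
    by simp
qed

text \<open>\<open>W\<close> is a walk together with a short path to the neighbourhood of each
  earlier set. The last conjunct is the dichotomy required by \<open>branch_sets_exist\<close>:
  \<open>walk_edges_le\<close> gives it for the walk, and the detours are too few to spoil
  it.\<close>

lemma sparse_extension:
  fixes l :: nat
  assumes "1 \<le> l" "d * l \<le> 4 * card R" "finite F"
    and hit: "\<And>V. V \<in> F \<Longrightarrow> hit_const c * d * l \<le> card (E `` V \<inter> R)"
  defines "y \<equiv> c\<^sup>2 / 8 * (hit_const c * d * l / card R) * l"
  assumes y: "1 \<le> c * y"
    and cost: "card F * (2 * exp (- y) + 2 / c * exp (- (c\<^sup>2 * l / 16))) \<le> detour_const c * l / 2"
  shows "\<exists>W\<subseteq>R. W \<noteq> {} \<and> conn E W \<and> card W \<le> 3 * l \<and> (\<forall>V\<in>F. E `` V \<inter> W \<noteq> {})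
    \<and> (\<forall>R'\<subseteq>R. hit_const c * d * l \<le> card (E `` W \<inter> R') \<or> card (E \<inter> W \<times> R') \<le> c * d * card W)"
proof -
  interpret mixing_kernel R lazy_walk "c\<^sup>2 / 4" by (rule lazy_walk_mixing)
  let ?\<delta> = "detour_const c" and ?K = "visits_const c"
  let ?A = "\<lambda>V. E `` V \<inter> R"
  have K: "?K > 0" and \<delta>: "?\<delta> > 0" "?\<delta> \<le> 1"
    using visits_const_ge[OF c_pos c_le_1] detour_const_bounds[OF c_pos c_le_1] by auto
  define f1 where "f1 ws = (\<Sum>v\<in>R. (visits (E `` {v} \<inter> R) ws)\<^sup>2)" for ws
  \<comment> \<open>Total distance from the walk to the neighbourhoods: each inner sum counts the
    radii whose balls are avoided.\<close>
  define f2 :: "'a list \<Rightarrow> real" where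
    "f2 ws = (\<Sum>V\<in>F. \<Sum>r<card R. of_bool (set ws \<subseteq> R - nball E R (?A V) r))" for ws
  have "walk_mean l f2 = (\<Sum>V\<in>F. \<Sum>r<card R. walk_mean l (\<lambda>ws. of_bool (set ws \<subseteq> R - nball E R (?A V) r)))"
    unfolding f2_def[abs_def] using assms(3) by (simp only: walk_mean_sum finite_lessThan)
  also have "\<dots> \<le> (\<Sum>V\<in>F. 2 * exp (- y) + 2 / c * exp (- (c\<^sup>2 * l / 16)))"
  proof (rule sum_mono)
    fix V assume V: "V \<in> F"
    let ?y = "c\<^sup>2 / 8 * (real (card (?A V)) / card R) * l"
    have yy: "y \<le> ?y"
      unfolding y_def using hit[OF V] by (intro mult_right_mono mult_left_mono divide_right_mono) auto
    then have "c * y \<le> c * ?y"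
      using c_pos by (intro mult_left_mono) auto
    then have "1 \<le> c * ?y" using y by linarith
    with sum_walk_avoid_nball[of "?A V" l "card R"] yy
    show "(\<Sum>r<card R. walk_mean l (\<lambda>ws. of_bool (set ws \<subseteq> R - nball E R (?A V) r)))
        \<le> 2 * exp (- y) + 2 / c * exp (- (c\<^sup>2 * l / 16))"
      by (smt (verit) Int_lower2 exp_le_cancel_iff)
  qed
  also have "\<dots> \<le> ?\<delta> * l / 2"
    using cost by simp
  finally have m2: "walk_mean l f2 \<le> ?\<delta> * l / 2" .
  have m1: "walk_mean l f1 \<le> ?K * d * l / 2"
    unfolding f1_def[abs_def] by (rule sum_visits_sq[OF assms(1,2)])
  \<comment> \<open>Twice the bounds on the means: each normalised mean is at most 1/2, so one
    trajectory obeys both bounds at once.\<close>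
  define a b where "a = ?K * d * l" and "b = ?\<delta> * l"
  have pos: "a > 0" "b > 0"
    using K \<delta> d_pos assms(1) by (auto simp: a_def b_def)
  let ?f = "\<lambda>ws. 1 / a * f1 ws + 1 / b * f2 ws"
  have "walk_mean l ?f = 1 / a * walk_mean l f1 + 1 / b * walk_mean l f2"
    by (simp only: walk_mean_add walk_mean_cmult)
  moreover have "1 / a * walk_mean l f1 \<le> 1 / 2" "1 / b * walk_mean l f2 \<le> 1 / 2"
    using m1[folded a_def] m2[folded b_def] pos by (simp_all add: field_simps)
  ultimately have "walk_mean l ?f \<le> 1" by linarith
  then obtain ws where ws: "length ws = l + 1" "set ws \<subseteq> R" "successively (\<lambda>x y. lazy_walk x y > 0) ws"
    "?f ws \<le> 1"
    using walk_mean_ex[of l ?f] by force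
  have "0 \<le> f1 ws" "0 \<le> f2 ws"
    by (auto simp: f1_def f2_def intro!: sum_nonneg)
  then have "0 \<le> 1 / a * f1 ws" "0 \<le> 1 / b * f2 ws"
    using pos by auto
  with ws(4) have "1 / a * f1 ws \<le> 1" "1 / b * f2 ws \<le> 1"
    by linarith+
  then have f1: "f1 ws \<le> ?K * d * l" and f2: "f2 ws \<le> ?\<delta> * l"
    unfolding a_def[symmetric] b_def[symmetric] using pos by (auto simp: pos_divide_le_eq)
  have "\<exists>Q\<subseteq>R. finite Q \<and> conn E Q \<and> Q \<inter> set ws \<noteq> {} \<and> Q \<inter> E `` V \<noteq> {}
      \<and> real (card (Q - set ws)) \<le> (\<Sum>r<card R. of_bool (set ws \<subseteq> R - nball E R (?A V) r))" if V: "V \<in> F" for V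
  proof -
    have "?A V \<noteq> {}"
      using hit[OF V] hit_const_pos[OF c_pos c_le_1] d_pos assms(1)
      by (auto simp: not_le mult_le_0_iff)
    then have "nball E R (?A V) (card R) = R" by (intro nball_eq_R) auto
    moreover have "set ws \<noteq> {}" using ws(1) by auto
    ultimately have ex: "set ws \<inter> nball E R (?A V) (card R) \<noteq> {}"
      using ws(2) by (simp add: Int_absorb2)
    define r where "r = (LEAST r. set ws \<inter> nball E R (?A V) r \<noteq> {})"
    have r: "set ws \<inter> nball E R (?A V) r \<noteq> {}"
      unfolding r_def by (rule LeastI[of "\<lambda>r. set ws \<inter> nball E R (?A V) r \<noteq> {}", OF ex])
    have r_le: "r \<le> card R"
      unfolding r_def by (rule Least_le[of "\<lambda>r. set ws \<inter> nball E R (?A V) r \<noteq> {}", OF ex])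
    obtain w where w: "w \<in> set ws" "w \<in> nball E R (?A V) r" using r by auto
    obtain Q where Q: "Q \<subseteq> R" "finite Q" "conn E Q" "w \<in> Q" "Q \<inter> ?A V \<noteq> {}" "card Q \<le> r + 1"
      using nball_path[OF sym_E _ w(2)] by auto
    \<comment> \<open>The path starts on the walk, so length \<open>r\<close> adds at most
      \<open>r\<close> vertices.\<close>
    have "card (Q - set ws) \<le> card (Q - {w})"
      using Q(2) w(1) by (intro card_mono) auto
    then have "card (Q - set ws) \<le> r"
      using Q(2,4,6) by simp
    moreover have "real r = (\<Sum>s<r. of_bool (set ws \<subseteq> R - nball E R (?A V) s))"
    proof -
      have "set ws \<subseteq> R - nball E R (?A V) s" if "s < r" for s
        using not_less_Least[of s "\<lambda>r. set ws \<inter> nball E R (?A V) r \<noteq> {}"] that ws(2)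
        by (auto simp: r_def)
      then show ?thesis by simp
    qed
    moreover have "\<dots> \<le> (\<Sum>s<card R. of_bool (set ws \<subseteq> R - nball E R (?A V) s) :: real)"
      using r_le by (intro sum_mono2) auto
    ultimately have "real (card (Q - set ws)) \<le> (\<Sum>s<card R. of_bool (set ws \<subseteq> R - nball E R (?A V) s))"
      by linarith
    with Q w(1) show ?thesis by (intro exI[of _ Q]) blast
  qed
  then obtain Q where Q: "\<And>V. V \<in> F \<Longrightarrow> Q V \<subseteq> R \<and> finite (Q V) \<and> conn E (Q V)
      \<and> Q V \<inter> set ws \<noteq> {} \<and> Q V \<inter> E `` V \<noteq> {}
      \<and> real (card (Q V - set ws)) \<le> (\<Sum>r<card R. of_bool (set ws \<subseteq> R - nball E R (?A V) r))"
    by metis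
  define D where "D = (\<Union>V\<in>F. Q V - set ws)"
  define W where "W = set ws \<union> (\<Union>V\<in>F. Q V)"
  have W_eq: "W = set ws \<union> D" by (auto simp: W_def D_def)
  have D_R: "D \<subseteq> R" using Q by (auto simp: D_def)
  have W_R: "W \<subseteq> R" using D_R ws(2) by (auto simp: W_eq)
  have finW: "finite W" using W_R finite_R by (rule finite_subset)
  have "card D \<le> (\<Sum>V\<in>F. card (Q V - set ws))"
    unfolding D_def by (rule card_UN_le[OF assms(3)])
  then have "real (card D) \<le> (\<Sum>V\<in>F. real (card (Q V - set ws)))"
    by (metis of_nat_le_iff of_nat_sum)
  also have "\<dots> \<le> f2 ws"
    unfolding f2_def using Q by (intro sum_mono) auto
  finally have D: "real (card D) \<le> ?\<delta> * l" using f2 by linarith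
  have "conn E (set ws)"
    using ws by (intro conn_successively[OF sym_E]) (auto intro: successively_mono dest: lazy_walk_pos)
  then have conn: "conn E W"
    unfolding W_def using Q by (intro conn_UN[OF sym_E _ assms(3)]) auto
  have card_W: "card W \<le> 3 * l"
  proof -
    have "?\<delta> * real l \<le> 1 * real l"
      using \<delta>(2) by (intro mult_right_mono) auto
    then have "card D \<le> l" using D by linarith
    then show ?thesis
      unfolding W_eq using card_Un_le[of "set ws" D] card_length[of ws] ws(1) assms(1) by linarith
  qed
  have acc: "hit_const c * d * l \<le> card (E `` W \<inter> R') \<or> card (E \<inter> W \<times> R') \<le> c * d * card W"
    if R': "R' \<subseteq> R" for R'
  proof (rule disjCI)
    assume "\<not> card (E \<inter> W \<times> R') \<le> c * d * card W"
    moreover have "card (E \<inter> W \<times> R') \<le> c * d * card W"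
      if few: "card (E `` W \<inter> R') < hit_const c * d * l"
    proof -
      have finR': "finite R'" using R' finite_R by (rule finite_subset)
      have "card (E `` set ws \<inter> R') \<le> card (E `` W \<inter> R')"
        using finR' by (intro card_mono) (auto simp: W_eq)
      then have "card (E `` set ws \<inter> R') \<le> hit_const c * d * l"
        using few by linarith
      then have e1: "card (E \<inter> set ws \<times> R') \<le> ?\<delta> * d * l"
        using f1 unfolding f1_def by (intro walk_edges_le ws(2) R')
      have e2: "real (card (E \<inter> D \<times> R')) \<le> d * card D"
        by (rule edges_le_left[OF D_R R'])
      have "E \<inter> W \<times> R' = (E \<inter> set ws \<times> R') \<union> (E \<inter> D \<times> R')"
        by (auto simp: W_eq)
      then have "real (card (E \<inter> W \<times> R')) \<le> card (E \<inter> set ws \<times> R') + card (E \<inter> D \<times> R')"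
        by (metis card_Un_le of_nat_add of_nat_le_iff)
      also have "\<dots> \<le> ?\<delta> * d * l + d * (?\<delta> * l)"
      proof -
        have "d * card D \<le> d * (?\<delta> * l)"
          using D d_pos by (intro mult_left_mono) auto
        then show ?thesis using e1 e2 unfolding of_nat_add by linarith
      qed
      also have "\<dots> = c * d * (c\<^sup>2 * l / ?K)"
        using K by (simp add: detour_const_def power2_eq_square power3_eq_cube)
      also have "\<dots> \<le> c * d * card (set ws)"
        using walk_image_large[OF assms(1) ws(2,1) f1[unfolded f1_def]] K c_pos d_pos
        by (intro mult_left_mono) (auto simp: pos_divide_le_eq mult.commute)
      also have "\<dots> \<le> c * d * card W"
        using c_pos d_pos finW by (intro mult_left_mono) (auto simp: W_eq intro!: card_mono)
      finally show ?thesis .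
    qed
    ultimately show "hit_const c * d * l \<le> card (E `` W \<inter> R')" by fastforce
  qed
  have "W \<noteq> {}" using ws(1) by (auto simp: W_def)
  moreover have "E `` V \<inter> W \<noteq> {}" if "V \<in> F" for V
    using Q[OF that] that by (auto simp: W_def)
  ultimately show ?thesis
    using W_R conn card_W acc by (intro exI[of _ W]) blast
qed

end

subsection \<open>Branch sets from independent samples\<close>

text \<open>Independent samples as a Markov chain: one step replaces \<open>f\<close> by its mean,
  so the gap is full and the avoidance bound applies unchanged.\<close>

lemma uniform_mixing:
  assumes "finite R" "R \<noteq> {}"
  shows "mixing_kernel R (\<lambda>x y. 1 / card R) 1"
proof
  fix f :: "'a \<Rightarrow> real"
  have N: "card R > 0" using assms by (simp add: card_gt_0_iff)
  have "(\<Sum>x\<in>R. (\<Sum>y\<in>R. 1 / card R * f y)\<^sup>2) = (\<Sum>y\<in>R. f y)\<^sup>2 / card R"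
    using N by (simp add: sum_divide_distrib[symmetric] power2_eq_square)
  then show "(\<Sum>x\<in>R. (\<Sum>y\<in>R. 1 / card R * f y)\<^sup>2)
      \<le> (\<Sum>x\<in>R. (f x)\<^sup>2) - 1 * ((\<Sum>x\<in>R. (f x)\<^sup>2) - (\<Sum>x\<in>R. f x)\<^sup>2 / card R)"
    by simp
qed (use assms in auto)

context expander
begin

text \<open>Take a pair with \<open>M\<close> as large as possible. If radius 2 did not suffice,
  some vertex would be at distance exactly 3 from \<open>B\<close>; its neighbourhood is disjoint
  from those of \<open>M\<close>, and joining it to \<open>B\<close> costs three vertices. Disjoint
  neighbourhoods of size at least c d bound |M| by |R| / (c d).\<close>

lemma backbone:
  "\<exists>B\<subseteq>R. B \<noteq> {} \<and> conn E B \<and> nball E R B 2 = R \<and> c * d * card B \<le> 3 * card R"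
proof -
  \<comment> \<open>Each new member of \<open>M\<close> brings at most 3 vertices into
    \<open>B\<close>; the offset 2 is exact for the start \<open>({x}, {x})\<close>.\<close>
  define P where "P = (\<lambda>(B, M). B \<subseteq> R \<and> conn E B \<and> M \<subseteq> B \<and> card B + 2 \<le> 3 * card M
    \<and> (\<forall>u\<in>M. \<forall>v\<in>M. u \<noteq> v \<longrightarrow> E `` {u} \<inter> E `` {v} \<inter> R = {}))"
  obtain x where "x \<in> R" using R_nonempty by auto
  then have "P ({x}, {x})" by (simp add: P_def conn_singleton)
  moreover have "card (snd p) < Suc (card R)" if "P p" for p
    using that finite_R by (auto simp: P_def less_Suc_eq_le intro!: card_mono)
  ultimately obtain p where p: "P p" "\<And>p'. P p' \<Longrightarrow> card (snd p') \<le> card (snd p)"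
    using ex_has_greatest_nat[of P "({x}, {x})" "\<lambda>p. card (snd p)" "Suc (card R)"] by blast
  obtain B M where BM: "p = (B, M)" by (cases p)
  have B: "B \<subseteq> R" "conn E B" "M \<subseteq> B" "card B + 2 \<le> 3 * card M"
    and disj: "\<And>u v. u \<in> M \<Longrightarrow> v \<in> M \<Longrightarrow> u \<noteq> v \<Longrightarrow> E `` {u} \<inter> E `` {v} \<inter> R = {}"
    using p(1) by (auto simp: P_def BM)
  have fin: "finite B" "finite M"
    using B finite_R by (auto intro: finite_subset)
  have "M \<noteq> {}" using B(4) by auto
  have far: "nball E R B 2 = R"
  proof (rule ccontr)
    assume "nball E R B 2 \<noteq> R"
    then have "\<not> E `` nball E R B 2 \<inter> R \<subseteq> nball E R B 2"
      using closed_eq_R[OF nball_subset[OF B(1), of E 2]] nball_mono[of 0 2 E R B] B(3) \<open>M \<noteq> {}\<close>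
      by fastforce
    then obtain v where v: "v \<in> R" "v \<in> nball E R B (Suc 2)" "v \<notin> nball E R B 2"
      unfolding nball.simps by blast
    obtain Q where Q: "Q \<subseteq> R" "finite Q" "conn E Q" "v \<in> Q" "Q \<inter> B \<noteq> {}" "card Q \<le> Suc 2 + 1"
      using nball_path[OF sym_E B(1) v(2)] by blast
    obtain b where b: "b \<in> Q" "b \<in> B" using Q(5) by auto
    have v_B: "v \<notin> B" using v(3) nball_mono[of 0 2 E R B] by auto
    have "conn E (B \<union> Q)"
      using b by (intro conn_Un[OF sym_E B(2) Q(3), where x = b and y = b]) auto
    moreover have "card (B \<union> Q) + 2 \<le> 3 * card (insert v M)"
    proof -
      have "card (Q - B) \<le> card (Q - {b})"
        using Q(2) b by (intro card_mono) auto
      also have "\<dots> \<le> 3" using Q(2,6) b by simp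
      finally have "card (B \<union> Q) \<le> card B + 3"
        using card_Un_le[of B "Q - B"] by simp
      then show ?thesis using B(3,4) v_B fin by (auto simp: card_insert_if)
    qed
    moreover have "E `` {u} \<inter> E `` {v} \<inter> R = {}" if "u \<in> M" for u
    proof (rule ccontr)
      assume "\<not> ?thesis"
      then obtain y where y: "(u, y) \<in> E" "(v, y) \<in> E" "y \<in> R" by auto
      then have "y \<in> nball E R B (Suc 0)" using that B(3) by auto
      then have "v \<in> nball E R B (Suc (Suc 0))" using y sym_E v(1) by (auto dest: symD)
      then show False using v(3) by (simp add: numeral_2_eq_2)
    qed
    ultimately have "P (B \<union> Q, insert v M)"
      using B(1,3) Q(1,4) disj unfolding P_def by blast
    then have "card (insert v M) \<le> card M" using p(2) by (fastforce simp: BM)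
    then show False using v_B B(3) fin by (auto simp: card_insert_if split: if_splits)
  qed
  have "c * d * card M \<le> (\<Sum>u\<in>M. real (card (E `` {u} \<inter> R)))"
    using degree_ge B(1,3) sum_bounded_below[of M "c * d" "\<lambda>u. real (card (E `` {u} \<inter> R))"]
    by (auto simp: mult.commute)
  also have "\<dots> = card (\<Union>u\<in>M. E `` {u} \<inter> R)"
    using fin finite_R disj by (subst card_UN_disjoint) auto
  also have "\<dots> \<le> card R"
    using finite_R by (intro of_nat_mono card_mono) auto
  finally have M: "c * d * card M \<le> card R" .
  have "c * d * card B \<le> c * d * (3 * card M)"
    using B(4) c_pos d_pos by (intro mult_left_mono) auto
  then have "c * d * card B \<le> 3 * card R" using M by linarith
  with B \<open>M \<noteq> {}\<close> far show ?thesis by blast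
qed

text \<open>Two demands on one sample: to meet the neighbourhoods of all of \<open>F\<close>, by a
  union bound with failure below 1/2, and to leave few vertices of \<open>R\<close> without a
  neighbour in the sample, by Markov's inequality. The second makes the new set easy to hit later.
  The length 2 q + 1 offsets the square root in \<open>walk_avoid_le\<close>.\<close>

lemma random_sample:
  fixes \<mu> :: real
  assumes "finite F" "\<And>V. V \<in> F \<Longrightarrow> card (R - E `` V) \<le> \<mu> * card R"
    and "0 \<le> \<mu>" "card F * \<mu> ^ q < 1 / 2"
  shows "\<exists>ws. set ws \<subseteq> R \<and> length ws = 2 * q + 1 \<and> (\<forall>V\<in>F. E `` V \<inter> set ws \<noteq> {})
    \<and> card (R - E `` set ws) \<le> 2 * card R * exp (- (c * d * q / card R))"
proof -
  interpret mixing_kernel R "\<lambda>x y. 1 / card R" 1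
    using finite_R R_nonempty by (rule uniform_mixing)
  have avoid: "walk_mean (2 * q) (\<lambda>ws. of_bool (set ws \<subseteq> Z)) \<le> (real (card Z) / card R) ^ q"
    if Z: "Z \<subseteq> R" for Z
  proof -
    let ?z = "real (card Z) / card R"
    have z: "0 \<le> ?z" "?z \<le> 1"
      using card_mono[OF finite_R Z] card_R_pos by auto
    have "walk_mean (2 * q) (\<lambda>ws. of_bool (set ws \<subseteq> Z)) \<le> ?z * sqrt ?z ^ (2 * q)"
      using walk_avoid_le[OF Z, of "2 * q"] by simp
    also have "\<dots> = ?z * ?z ^ q"
      using z(1) by (simp add: power_mult)
    also have "\<dots> \<le> 1 * ?z ^ q"
      using z by (intro mult_right_mono) auto
    finally show ?thesis by simp
  qed
  define f1 :: "'a list \<Rightarrow> real" where "f1 ws = (\<Sum>V\<in>F. of_bool (set ws \<subseteq> R - E `` V))" for ws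
  define f2 :: "'a list \<Rightarrow> real" where "f2 ws = (\<Sum>v\<in>R. of_bool (set ws \<subseteq> R - E `` {v}))" for ws
  have "walk_mean (2 * q) f1 = (\<Sum>V\<in>F. walk_mean (2 * q) (\<lambda>ws. of_bool (set ws \<subseteq> R - E `` V)))"
    unfolding f1_def[abs_def] by (rule walk_mean_sum[OF assms(1)])
  also have "\<dots> \<le> (\<Sum>V\<in>F. \<mu> ^ q)"
  proof (rule sum_mono)
    fix V assume "V \<in> F"
    then have "real (card (R - E `` V)) / card R \<le> \<mu>"
      using assms(2) card_R_pos by (simp add: pos_divide_le_eq)
    then show "walk_mean (2 * q) (\<lambda>ws. of_bool (set ws \<subseteq> R - E `` V)) \<le> \<mu> ^ q"
      by (intro order_trans[OF avoid] power_mono) auto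
  qed
  also have "\<dots> < 1 / 2" using assms(4) by simp
  finally have m1: "walk_mean (2 * q) f1 < 1 / 2" .
  define b where "b = card R * exp (- (c * d * q / card R))"
  have b: "b > 0" using card_R_pos by (simp add: b_def)
  have "walk_mean (2 * q) f2 = (\<Sum>v\<in>R. walk_mean (2 * q) (\<lambda>ws. of_bool (set ws \<subseteq> R - E `` {v})))"
    unfolding f2_def[abs_def] by (rule walk_mean_sum[OF finite_R])
  also have "\<dots> \<le> (\<Sum>v\<in>R. exp (- (c * d * q / card R)))"
  proof (rule sum_mono)
    fix v assume v: "v \<in> R"
    have "card (R - E `` {v}) + card (E `` {v} \<inter> R) = card R"
      using finite_R card_Un_disjoint[of "R - E `` {v}" "E `` {v} \<inter> R"]
      by (simp add: Un_Diff_Int Int_commute Diff_Int_distrib2)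
    then have "real (card (R - E `` {v})) \<le> card R - c * d"
      using degree_ge[OF v] by linarith
    then have "real (card (R - E `` {v})) / card R \<le> 1 - c * d / card R"
      using card_R_pos by (simp add: field_simps)
    also have "\<dots> \<le> exp (- (c * d / card R))"
      using exp_ge_add_one_self[of "- (c * d / card R)"] by simp
    finally have "(real (card (R - E `` {v})) / card R) ^ q \<le> exp (- (c * d / card R)) ^ q"
      by (intro power_mono) auto
    also have "\<dots> = exp (- (c * d * q / card R))"
      by (simp only: exp_of_nat_mult[symmetric]) (simp add: mult_ac)
    finally show "walk_mean (2 * q) (\<lambda>ws. of_bool (set ws \<subseteq> R - E `` {v})) \<le> exp (- (c * d * q / card R))"
      by (intro order_trans[OF avoid]) auto
  qed
  also have "\<dots> = b" by (simp add: b_def)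
  finally have m2: "walk_mean (2 * q) f2 \<le> b" .
  let ?f = "\<lambda>ws. f1 ws + 1 / (2 * b) * f2 ws"
  have "walk_mean (2 * q) ?f = walk_mean (2 * q) f1 + 1 / (2 * b) * walk_mean (2 * q) f2"
    by (simp only: walk_mean_add walk_mean_cmult)
  moreover have "1 / (2 * b) * walk_mean (2 * q) f2 \<le> 1 / 2"
    using m2 b by (simp add: field_simps)
  ultimately have "walk_mean (2 * q) ?f < 1" using m1 by linarith
  then obtain ws where ws: "length ws = 2 * q + 1" "set ws \<subseteq> R" "?f ws < 1"
    using walk_mean_ex[of "2 * q" ?f] by force
  have "0 \<le> f1 ws" "0 \<le> f2 ws"
    by (auto simp: f1_def f2_def intro!: sum_nonneg)
  moreover from this have "0 \<le> 1 / (2 * b) * f2 ws"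
    using b by simp
  ultimately have f1: "f1 ws < 1" and "1 / (2 * b) * f2 ws < 1"
    using ws(3) by linarith+
  then have f2: "f2 ws \<le> 2 * b" using b by (simp add: field_simps)
  have "E `` V \<inter> set ws \<noteq> {}" if "V \<in> F" for V
  proof
    assume "E `` V \<inter> set ws = {}"
    then have "set ws \<subseteq> R - E `` V" using ws(2) by auto
    then have "1 \<le> f1 ws"
      using member_le_sum[of V F "\<lambda>V. of_bool (set ws \<subseteq> R - E `` V) :: real"] that assms(1)
      by (simp add: f1_def del: sum_of_bool_eq)
    then show False using f1 by simp
  qed
  moreover have "real (card (R - E `` set ws)) = f2 ws"
  proof -
    have "f2 ws = (\<Sum>v\<in>R - E `` set ws. 1)"
      unfolding f2_def using finite_R ws(2) sym_E
      by (intro sum.mono_neutral_cong_right) (auto dest: symD)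
    then show ?thesis by simp
  qed
  ultimately show ?thesis
    using ws f2 by (intro exI[of _ ws]) (auto simp: b_def mult.assoc)
qed

text \<open>Each sample is joined to the backbone by a path of at most 3 vertices, and 3 (2 q + 1)
  <= 9 q. Enlarging the sample to \<open>W\<close> can only add neighbours.\<close>

lemma dense_extension:
  fixes \<mu> :: real
  assumes "finite F" "\<And>V. V \<in> F \<Longrightarrow> card (R - E `` V) \<le> \<mu> * card R"
    and "0 \<le> \<mu>" "card F * \<mu> ^ q < 1 / 2" "1 \<le> q"
  shows "\<exists>W\<subseteq>R. W \<noteq> {} \<and> conn E W \<and> real (card W) \<le> 3 * card R / (c * d) + 9 * q
    \<and> (\<forall>V\<in>F. E `` V \<inter> W \<noteq> {})
    \<and> card (R - E `` W) \<le> 2 * card R * exp (- (c * d * q / card R))"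
proof -
  obtain B where B: "B \<subseteq> R" "B \<noteq> {}" "conn E B" "nball E R B 2 = R" "c * d * card B \<le> 3 * card R"
    using backbone by blast
  obtain ws where ws: "set ws \<subseteq> R" "length ws = 2 * q + 1" "\<And>V. V \<in> F \<Longrightarrow> E `` V \<inter> set ws \<noteq> {}"
    "card (R - E `` set ws) \<le> 2 * card R * exp (- (c * d * q / card R))"
    using random_sample[OF assms(1-4)] by blast
  have "\<exists>Q\<subseteq>R. finite Q \<and> conn E Q \<and> w \<in> Q \<and> Q \<inter> B \<noteq> {} \<and> card Q \<le> 2 + 1" if "w \<in> set ws" for w
    using ws(1) that B(4) by (intro nball_path[OF sym_E B(1)]) auto
  then obtain Q where Q: "\<And>w. w \<in> set ws \<Longrightarrow> Q w \<subseteq> R \<and> finite (Q w) \<and> conn E (Q w) \<and> w \<in> Q w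
      \<and> Q w \<inter> B \<noteq> {} \<and> card (Q w) \<le> 2 + 1"
    by metis
  define W where "W = B \<union> (\<Union>w\<in>set ws. Q w)"
  have W_R: "W \<subseteq> R" using B(1) Q by (auto simp: W_def)
  have sub: "set ws \<subseteq> W" using Q by (auto simp: W_def)
  have conn: "conn E W"
    unfolding W_def using Q by (intro conn_UN[OF sym_E B(3)]) auto
  have "card (\<Union>w\<in>set ws. Q w) \<le> (\<Sum>w\<in>set ws. card (Q w))"
    by (rule card_UN_le) simp
  also have "\<dots> \<le> (\<Sum>w\<in>set ws. 3)"
    using Q by (intro sum_mono) auto
  also have "\<dots> \<le> 3 * (2 * q + 1)"
    using card_length[of ws] ws(2) by simp
  finally have "card W \<le> card B + 3 * (2 * q + 1)"
    unfolding W_def using card_Un_le[of B "\<Union>w\<in>set ws. Q w"] by linarith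
  then have "real (card W) \<le> card B + 9 * q"
    using assms(5) by simp
  moreover have "real (card B) \<le> 3 * card R / (c * d)"
    using B(5) c_pos d_pos by (simp add: pos_le_divide_eq mult.commute)
  ultimately have card_W: "real (card W) \<le> 3 * card R / (c * d) + 9 * q"
    by linarith
  have "card (R - E `` W) \<le> card (R - E `` set ws)"
    using finite_R sub by (intro card_mono) auto
  with ws(4) have "card (R - E `` W) \<le> 2 * card R * exp (- (c * d * q / card R))"
    by linarith
  moreover have "E `` V \<inter> W \<noteq> {}" if "V \<in> F" for V
    using ws(3)[OF that] sub by auto
  ultimately show ?thesis
    using W_R B(2) conn card_W by (intro exI[of _ W]) (auto simp: W_def)
qed

end

subsection \<open>Discarding badly connected sets\<close>

lemma card_edges_Un_left:
  "card (E \<inter> (A \<union> B) \<times> X) \<le> card (E \<inter> A \<times> X) + card (E \<inter> B \<times> X)"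
proof -
  have "E \<inter> (A \<union> B) \<times> X = (E \<inter> A \<times> X) \<union> (E \<inter> B \<times> X)" by auto
  then show ?thesis by (simp add: card_Un_le)
qed

lemma card_edges_Un_right:
  "card (E \<inter> X \<times> (A \<union> B)) \<le> card (E \<inter> X \<times> A) + card (E \<inter> X \<times> B)"
proof -
  have "E \<inter> X \<times> (A \<union> B) = (E \<inter> X \<times> A) \<union> (E \<inter> X \<times> B)" by auto
  then show ?thesis by (simp add: card_Un_le)
qed

lemma card_edges_mono:
  "finite A' \<Longrightarrow> finite B' \<Longrightarrow> A \<subseteq> A' \<Longrightarrow> B \<subseteq> B' \<Longrightarrow> card (E \<inter> A \<times> B) \<le> card (E \<inter> A' \<times> B')"
  by (intro card_mono) auto

text \<open>A branch set that has lost its neighbours in the remaining graph \<open>R\<close>, or a part of \<open>R\<close> that is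
  poorly connected to the rest of \<open>R\<close>, is moved to a discarded set \<open>D\<close>. As \<open>D\<close> sends few edges to
  \<open>R\<close>, the expansion of the whole graph keeps it small. The argument is run on a state that
  maximises lexicographically the size of \<open>D\<close> and the number of branch sets.\<close>

lemma branch_sets_exist:
  fixes V :: "'a set" and E :: "('a \<times> 'a) set" and \<epsilon> d s :: real
    and Good :: "'a set \<Rightarrow> 'a set \<Rightarrow> bool"
  assumes finV: "finite V" and cardV: "3 \<le> card V" and symE: "sym E"
    and deg: "\<And>x. x \<in> V \<Longrightarrow> real (card (E `` {x} \<inter> V)) \<le> d"
    and iso: "\<And>S. S \<subseteq> V \<Longrightarrow> 2 * card S \<le> card V
      \<Longrightarrow> \<epsilon> * d * card S \<le> card (E \<inter> S \<times> (V - S))"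
    and \<epsilon>: "0 < \<epsilon>" "\<epsilon> \<le> 1" and d: "0 < d" and s: "0 \<le> s"
    and ts: "t * s \<le> \<epsilon>\<^sup>2 / 100 * card V"
  defines "c \<equiv> \<epsilon> / 4"
  assumes ext: "\<And>R F. expander E R c d \<Longrightarrow> R \<subseteq> V \<Longrightarrow> 3 / 4 * card V \<le> card R \<Longrightarrow>
      finite F \<Longrightarrow> card F < t \<Longrightarrow> (\<And>W. W \<in> F \<Longrightarrow> Good W R) \<Longrightarrow>
      \<exists>W\<subseteq>R. W \<noteq> {} \<and> conn E W \<and> card W \<le> s \<and> (\<forall>B\<in>F. E `` B \<inter> W \<noteq> {})
        \<and> (\<forall>R'\<subseteq>R. Good W R' \<or> card (E \<inter> W \<times> R') \<le> c * d * card W)"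
  shows "\<exists>F. finite F \<and> card F = t \<and> disjoint F \<and> (\<forall>W\<in>F. W \<noteq> {} \<and> W \<subseteq> V \<and> conn E W)
    \<and> (\<forall>A\<in>F. \<forall>B\<in>F. A \<noteq> B \<longrightarrow> E `` A \<inter> B \<noteq> {})"
proof -
  let ?n = "card V"
  have c: "0 < c" "c \<le> 1" using \<epsilon> by (auto simp: c_def)
  define rest where "rest D F = V - D - \<Union>F" for D and F :: "'a set set"
  \<comment> \<open>The dichotomy is demanded for all subsets of \<open>rest D F\<close>, so it
    survives every later shrinking of the rest.\<close>
  define P where "P = (\<lambda>(D, F). D \<subseteq> V \<and> 2 * card D \<le> ?n \<and> finite F \<and> card F \<le> t \<and> disjoint F
    \<and> (\<forall>W\<in>F. W \<noteq> {} \<and> W \<subseteq> V \<and> conn E W \<and> card W \<le> s \<and> W \<inter> D = {})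
    \<and> (\<forall>A\<in>F. \<forall>B\<in>F. A \<noteq> B \<longrightarrow> E `` A \<inter> B \<noteq> {})
    \<and> (\<forall>W\<in>F. \<forall>R'\<subseteq>rest D F. Good W R' \<or> card (E \<inter> W \<times> R') \<le> c * d * card W)
    \<and> card (E \<inter> D \<times> rest D F) \<le> c * d * card D)"
  \<comment> \<open>The lexicographic order as one number: there are at most \<open>t\<close> branch
    sets, so one more vertex in \<open>D\<close> outweighs the loss of all of them.\<close>
  let ?m = "\<lambda>p :: 'a set \<times> 'a set set. card (fst p) * (t + 1) + card (snd p)"
  have "P ({}, {})" by (simp add: P_def)
  moreover have "?m p < Suc (?n * (t + 1) + t)" if "P p" for p
  proof -
    have "card (fst p) \<le> ?n" "card (snd p) \<le> t"
      using that finV by (auto simp: P_def intro!: card_mono)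
    then show ?thesis
      by (meson add_mono le_imp_less_Suc mult_le_mono1)
  qed
  ultimately obtain p where p: "P p" "\<And>p'. P p' \<Longrightarrow> ?m p' \<le> ?m p"
    using ex_has_greatest_nat[of P "({}, {})" ?m "Suc (?n * (t + 1) + t)"] by blast
  obtain D F where DF: "p = (D, F)" by (cases p)
  have D: "D \<subseteq> V" "2 * card D \<le> ?n" and F: "finite F" "card F \<le> t" "disjoint F"
    and W: "\<And>W. W \<in> F \<Longrightarrow> W \<noteq> {} \<and> W \<subseteq> V \<and> conn E W \<and> card W \<le> s \<and> W \<inter> D = {}"
    and adj: "\<And>A B. A \<in> F \<Longrightarrow> B \<in> F \<Longrightarrow> A \<noteq> B \<Longrightarrow> E `` A \<inter> B \<noteq> {}"
    and good: "\<And>W R'. W \<in> F \<Longrightarrow> R' \<subseteq> rest D F \<Longrightarrow> Good W R' \<or> card (E \<inter> W \<times> R') \<le> c * d * card W"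
    and cut: "card (E \<inter> D \<times> rest D F) \<le> c * d * card D"
    using p(1) unfolding P_def DF by auto
  have max_D: "card D' \<le> card D" if "P (D', F')" for D' F'
  proof (rule ccontr)
    assume "\<not> card D' \<le> card D"
    then have "(card D + 1) * (t + 1) \<le> card D' * (t + 1)"
      by (intro mult_le_mono1) simp
    then show False using p(2)[OF that] F(2) by (simp add: DF)
  qed
  have max_F: "card F' \<le> card F" if "P (D, F')" for F'
    using p(2)[OF that] by (simp add: DF)
  define U where "U = \<Union>F"
  define R where "R = rest D F"
  have sub: "U \<subseteq> V" "R \<subseteq> V" using W by (auto simp: U_def R_def rest_def)
  have fin: "finite D" "finite U" "finite R"
    using D(1) sub finV by (auto intro: finite_subset)
  have part: "V = D \<union> U \<union> R" "D \<inter> U = {}" "D \<inter> R = {}" "U \<inter> R = {}"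
  proof -
    show "D \<inter> U = {}" unfolding U_def using W by blast
  qed (use D(1) sub in \<open>auto simp: U_def R_def rest_def\<close>)
  have n_eq: "?n = card D + card U + card R"
    using fin part by (simp add: card_Un_disjoint Int_Un_distrib2)
  have "real (card U) \<le> (\<Sum>W\<in>F. real (card W))"
    unfolding U_def using card_UN_le[OF F(1), of "\<lambda>W. W"] by (simp flip: of_nat_sum)
  also have "\<dots> \<le> card F * s"
    using W sum_bounded_above[of F "\<lambda>W. real (card W)" s] by simp
  also have "\<dots> \<le> t * s"
    using F(2) s by (intro mult_right_mono) auto
  finally have U_le: "card U \<le> \<epsilon>\<^sup>2 / 100 * ?n" using ts by linarith
  have edges_left: "real (card (E \<inter> A \<times> B)) \<le> d * card A" if "A \<subseteq> V" "B \<subseteq> V" for A B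
  proof (rule card_edges_le)
    fix x assume "x \<in> A"
    then have "card (E `` {x} \<inter> B) \<le> card (E `` {x} \<inter> V)"
      using that finV by (intro card_mono) auto
    with deg[of x] \<open>x \<in> A\<close> that(1) show "real (card (E `` {x} \<inter> B)) \<le> d" by fastforce
  qed (use that finV in \<open>auto intro: finite_subset\<close>)
  have edges_right: "real (card (E \<inter> A \<times> B)) \<le> d * card B" if "A \<subseteq> V" "B \<subseteq> V" for A B
    using edges_left[OF that(2,1)] by (simp add: card_edges_sym[OF symE, of A])
  \<comment> \<open>Edges leaving \<open>D\<close> go to \<open>R\<close>, few by
    \<open>cut\<close>, or to \<open>U\<close>, at most d |U|. As c = \<epsilon> / 4, this gives
    (3/4) \<epsilon> |D| <= |U| <= \<epsilon>^2 n / 100.\<close>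
  have D_le: "card D \<le> ?n / 75"
  proof -
    have "\<epsilon> * d * card D \<le> card (E \<inter> D \<times> (V - D))"
      using D by (rule iso)
    also have "V - D = R \<union> U" using part by auto
    also have "real (card (E \<inter> D \<times> (R \<union> U))) \<le> card (E \<inter> D \<times> R) + card (E \<inter> D \<times> U)"
      using card_edges_Un_right[of E D R U] by linarith
    also have "\<dots> \<le> c * d * card D + d * card U"
      using cut edges_right[OF D(1) sub(1)] by (simp add: R_def)
    finally have "d * (\<epsilon> * card D) \<le> d * (c * card D + card U)"
      by (simp add: algebra_simps)
    then have "\<epsilon> * card D \<le> c * card D + card U"
      using d by simp
    then have "\<epsilon> * (3 / 4 * card D) \<le> \<epsilon> * (\<epsilon> / 100 * ?n)"
      using U_le by (simp add: c_def power2_eq_square)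
    then have "3 / 4 * card D \<le> \<epsilon> / 100 * ?n"
      using \<epsilon>(1) by (simp only: mult_le_cancel_left_pos)
    also have "\<dots> \<le> 1 / 100 * ?n"
      using \<epsilon>(2) by (intro mult_right_mono) auto
    finally show ?thesis by simp
  qed
  have eps2: "\<epsilon>\<^sup>2 \<le> \<epsilon>" using \<epsilon> by (simp add: power2_eq_square)
  have "\<epsilon>\<^sup>2 / 100 * ?n \<le> 1 / 100 * ?n"
    using eps2 \<epsilon>(2) by (intro mult_right_mono) auto
  then have U_le': "card U \<le> ?n / 100" using U_le by linarith
  have R_ge: "3 / 4 * ?n \<le> card R"
    using n_eq D_le U_le' by linarith
  \<comment> \<open>A set that is not good sends few edges to \<open>R\<close> and may join
    \<open>D\<close>; the rest is still \<open>R\<close>, but \<open>D\<close> has grown, against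
    maximality.\<close>
  have all_good: "Good W R" if WF: "W \<in> F" for W
  proof (rule ccontr)
    assume "\<not> Good W R"
    then have few: "card (E \<inter> W \<times> R) \<le> c * d * card W"
      using good[OF WF, of R] by (auto simp: R_def)
    have finW: "finite W" using W[OF WF] finV by (auto intro: finite_subset)
    have rest_eq: "rest (D \<union> W) (F - {W}) = R"
    proof -
      have "\<Union>(F - {W}) \<union> W = \<Union>F" using WF by auto
      then show ?thesis unfolding rest_def R_def by blast
    qed
    have card_DW: "card (D \<union> W) = card D + card W"
      using W[OF WF] fin finW by (intro card_Un_disjoint) auto
    have "card W \<le> card U"
      using fin WF by (intro card_mono) (auto simp: U_def)
    then have half: "2 * card (D \<union> W) \<le> ?n"
      using card_DW D_le U_le' by linarith
    have dis: "W' \<inter> W = {}" if "W' \<in> F - {W}" for W'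
      using F(3) that WF by (auto simp: disjoint_def)
    have e: "card (E \<inter> (D \<union> W) \<times> R) \<le> c * d * card (D \<union> W)"
      using card_edges_Un_left[of E D W R] few cut by (simp add: R_def card_DW distrib_left)
    have "P (D \<union> W, F - {W})"
      unfolding P_def prod.case rest_eq
    proof (intro conjI)
      show "D \<union> W \<subseteq> V" using D(1) W[OF WF] by auto
      show "disjoint (F - {W})" using F(3) by (auto simp: disjoint_def)
      show "card (F - {W}) \<le> t" using F(1,2) by (meson card_Diff1_le order_trans)
      show "\<forall>W'\<in>F - {W}. W' \<noteq> {} \<and> W' \<subseteq> V \<and> conn E W' \<and> card W' \<le> s \<and> W' \<inter> (D \<union> W) = {}"
        using W dis by (auto simp: Int_Un_distrib)
      show "\<forall>W'\<in>F - {W}. \<forall>R'\<subseteq>R. Good W' R' \<or> card (E \<inter> W' \<times> R') \<le> c * d * card W'"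
        using good by (auto simp: R_def)
    qed (use half F(1) adj e in auto)
    then have "card (D \<union> W) \<le> card D" by (rule max_D)
    then show False
      using card_DW W[OF WF] finW by simp
  qed
  have exp: "expander E R c d"
  proof
    show "2 \<le> card R" using R_ge cardV by linarith
    show "real (card (E `` {x} \<inter> R)) \<le> d" if "x \<in> R" for x
      using edges_left[of "{x}" R] that sub(2) fin(3) by (auto simp: card_edges_eq_sum)
    fix S assume S: "S \<subseteq> R" "2 * card S \<le> card R"
    \<comment> \<open>A set \<open>S\<close> violating expansion may join \<open>D\<close> in the
      same way, provided the enlarged \<open>D\<close> stays within half of
      \<open>V\<close>.\<close>
    show "c * d * card S \<le> card (E \<inter> S \<times> (R - S))"
    proof (rule ccontr)
      assume "\<not> ?thesis"
      then have few: "card (E \<inter> S \<times> (R - S)) < c * d * card S" by simp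
      have finS: "finite S" using S(1) fin(3) by (rule finite_subset)
      have pos: "card S > 0" using few c d by (cases "card S") auto
      have rest_eq: "rest (D \<union> S) F = R - S" by (auto simp: rest_def R_def)
      have card_DS: "card (D \<union> S) = card D + card S"
        using S(1) part fin finS by (intro card_Un_disjoint) auto
      have "card (E \<inter> D \<times> (R - S)) \<le> card (E \<inter> D \<times> R)"
        using fin by (intro card_edges_mono) auto
      then have e: "card (E \<inter> (D \<union> S) \<times> (R - S)) \<le> c * d * card (D \<union> S)"
        using card_edges_Un_left[of E D S "R - S"] few cut by (simp add: R_def card_DS distrib_left)
      \<comment> \<open>Otherwise the complement \<open>?T\<close> has at most half of the vertices,
        and global expansion bounds it by 26 n / 100: 1/4 from c = \<epsilon> / 4 and 1/100 from
        \<open>U\<close>. But |R - S| >= |R| / 2 >= 3 n / 8.\<close>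
      have half: "2 * card (D \<union> S) \<le> ?n"
      proof (rule ccontr)
        assume big: "\<not> ?thesis"
        let ?T = "(R - S) \<union> U"
        have T: "V - ?T = D \<union> S" "?T \<subseteq> V" using part S(1) sub by auto
        have card_T: "card ?T = card (R - S) + card U"
          using part(4) fin by (intro card_Un_disjoint) auto
        have RS: "card (R - S) = card R - card S"
          using S(1) finS by (simp add: card_Diff_subset)
        have "card S \<le> card R" using S(2) by simp
        then have "2 * card ?T \<le> ?n"
          using card_T RS n_eq card_DS big by linarith
        then have "\<epsilon> * d * card ?T \<le> card (E \<inter> ?T \<times> (D \<union> S))"
          using iso[OF T(2)] T(1) by simp
        also have "real (card (E \<inter> ?T \<times> (D \<union> S))) \<le> card (E \<inter> (R - S) \<times> (D \<union> S)) + card (E \<inter> U \<times> (D \<union> S))"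
          using card_edges_Un_left[of E "R - S" U "D \<union> S"] by linarith
        also have "\<dots> \<le> c * d * card (D \<union> S) + d * card U"
        proof -
          have "D \<union> S \<subseteq> V" using sub S(1) D(1) by auto
          with e edges_left[of U "D \<union> S"] sub(1) show ?thesis
            by (simp add: card_edges_sym[OF symE, of "R - S"])
        qed
        also have "\<dots> \<le> c * d * ?n + d * (\<epsilon> / 100 * ?n)"
        proof (intro add_mono mult_left_mono)
          show "real (card (D \<union> S)) \<le> ?n"
            using D(1) S(1) sub finV by (auto intro!: card_mono)
          have "\<epsilon>\<^sup>2 / 100 * ?n \<le> \<epsilon> / 100 * ?n"
            using eps2 by (intro mult_right_mono) auto
          then show "real (card U) \<le> \<epsilon> / 100 * ?n" using U_le by linarith
        qed (use c d in auto)
        finally have "(\<epsilon> * d) * card ?T \<le> (\<epsilon> * d) * (26 / 100 * ?n)"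
          by (simp add: c_def algebra_simps)
        then have "card ?T \<le> 26 / 100 * ?n"
          using \<epsilon>(1) d by simp
        moreover have "2 * card (R - S) \<ge> card R"
          using RS S(2) by linarith
        ultimately show False
          using R_ge card_T cardV by linarith
      qed
      have "P (D \<union> S, F)"
        unfolding P_def prod.case rest_eq
      proof (intro conjI)
        show "D \<union> S \<subseteq> V" using D(1) S(1) sub by auto
        show "\<forall>W\<in>F. W \<noteq> {} \<and> W \<subseteq> V \<and> conn E W \<and> card W \<le> s \<and> W \<inter> (D \<union> S) = {}"
          using W S(1) part(4) by (fastforce simp: U_def)
        show "\<forall>W\<in>F. \<forall>R'\<subseteq>R - S. Good W R' \<or> card (E \<inter> W \<times> R') \<le> c * d * card W"
          using good by (auto simp: R_def)
      qed (use half F adj e in auto)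
      then have "card (D \<union> S) \<le> card D" by (rule max_D)
      then show False using card_DS pos by simp
    qed
  qed (use fin symE c d in auto)
  have "card F = t"
  proof (rule ccontr)
    assume "card F \<noteq> t"
    then have "card F < t" using F(2) by simp
    then obtain X where X: "X \<subseteq> R" "X \<noteq> {}" "conn E X" "card X \<le> s"
      "\<And>B. B \<in> F \<Longrightarrow> E `` B \<inter> X \<noteq> {}"
      "\<And>R'. R' \<subseteq> R \<Longrightarrow> Good X R' \<or> card (E \<inter> X \<times> R') \<le> c * d * card X"
      using ext[OF exp sub(2) R_ge F(1) _ all_good] by meson
    have X_new: "X \<inter> W = {}" if "W \<in> F" for W
      using X(1) part(4) that by (auto simp: U_def)
    have "X \<notin> F" using X_new[of X] X(2) by auto
    have rest_sub: "rest D (insert X F) \<subseteq> R" by (auto simp: rest_def R_def)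
    have "P (D, insert X F)"
      unfolding P_def prod.case
    proof (intro conjI)
      show "card (insert X F) \<le> t" using \<open>card F < t\<close> \<open>X \<notin> F\<close> F(1) by simp
      show "disjoint (insert X F)"
        using F(3) X_new by (auto simp: disjoint_def Int_commute)
      show "\<forall>W\<in>insert X F. W \<noteq> {} \<and> W \<subseteq> V \<and> conn E W \<and> card W \<le> s \<and> W \<inter> D = {}"
        using W X part sub by blast
      show "\<forall>A\<in>insert X F. \<forall>B\<in>insert X F. A \<noteq> B \<longrightarrow> E `` A \<inter> B \<noteq> {}"
      proof -
        have "E `` X \<inter> B \<noteq> {}" if "B \<in> F" for B
          using X(5)[OF that] symE by (auto dest: symD)
        then show ?thesis using X(5) adj by blast
      qed
      show "\<forall>W\<in>insert X F. \<forall>R'\<subseteq>rest D (insert X F). Good W R' \<or> card (E \<inter> W \<times> R') \<le> c * d * card W"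
        using X(6) good rest_sub by (auto simp: R_def[symmetric])
      have "card (E \<inter> D \<times> rest D (insert X F)) \<le> card (E \<inter> D \<times> R)"
        using fin rest_sub by (intro card_edges_mono) auto
      then show "card (E \<inter> D \<times> rest D (insert X F)) \<le> c * d * card D"
        using cut by (simp add: R_def)
    qed (use D F in auto)
    then have "card (insert X F) \<le> card F" by (rule max_F)
    then show False using \<open>X \<notin> F\<close> F(1) by simp
  qed
  then show ?thesis using F W adj by blast
qed

subsection \<open>Choice of the parameters\<close>

locale cheeger_graph =
  fixes V :: "'a set" and E :: "('a \<times> 'a) set" and \<epsilon> :: real and d :: nat
  assumes finite_V: "finite V" and card_V: "3 \<le> card V" and sym_E: "sym E"
    and degree_le: "\<And>x. x \<in> V \<Longrightarrow> real (card (E `` {x} \<inter> V)) \<le> d"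
    and expansion: "\<And>S. S \<subseteq> V \<Longrightarrow> 2 * card S \<le> card V
      \<Longrightarrow> \<epsilon> * d * card S \<le> card (E \<inter> S \<times> (V - S))"
    and \<epsilon>: "0 < \<epsilon>" "\<epsilon> \<le> 1" and d_ge_3: "3 \<le> d"
begin

definition branch_sets :: "nat \<Rightarrow> 'a set set \<Rightarrow> bool" where
  "branch_sets t F \<longleftrightarrow> finite F \<and> card F = t \<and> disjoint F
    \<and> (\<forall>W\<in>F. W \<noteq> {} \<and> W \<subseteq> V \<and> conn E W) \<and> (\<forall>A\<in>F. \<forall>B\<in>F. A \<noteq> B \<longrightarrow> E `` A \<inter> B \<noteq> {})"

text \<open>\<open>order\<close> is the order of the clique minor to be found and \<open>width\<close> the size of its branch sets,
  both up to constant factors.\<close>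

definition order :: real where "order = sqrt (card V * d / ln d)"
definition width :: real where "width = sqrt (card V * ln d / d)"

lemma ln_d: "1 \<le> ln d" "ln d \<le> d"
proof -
  have "exp 1 \<le> (3 :: real)" by (rule exp_le)
  then have "exp 1 \<le> real d" using d_ge_3 by linarith
  then show "1 \<le> ln d" using d_ge_3 by (simp add: ln_ge_iff)
  show "ln d \<le> d" using d_ge_3 ln_bound[of "real d"] by simp
qed

lemma order_pos: "0 < order" and width_pos: "0 < width"
  using ln_d card_V d_ge_3 by (auto simp: order_def width_def)

lemma order_width: "order * width = card V"
  using ln_d d_ge_3 by (simp add: order_def width_def flip: real_sqrt_mult)

text \<open>The calibration: about \<open>width\<close> samples miss a set of about d *
  \<open>width\<close> vertices with probability about exp(- width^2 d / n) = 1 / d.\<close>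

lemma width_sq: "width * width * d = card V * ln d"
  using ln_d d_ge_3 by (simp add: width_def)

lemma order_eq: "order * ln d = d * width"
proof -
  have "order * width * (ln d) = width * width * d"
    unfolding order_width width_sq ..
  then have "width * (order * ln d) = width * (d * width)"
    by (simp add: mult_ac)
  then show ?thesis using width_pos by simp
qed

text \<open>The lower bound does not involve \<open>d\<close>, so \<open>n\<^sub>0\<close> can be
  chosen from \<epsilon> alone.\<close>

lemma order_ge: "sqrt (card V) \<le> order"
proof -
  have "real (card V) * 1 \<le> card V * (d / ln d)"
    using ln_d d_ge_3 by (intro mult_left_mono) (auto simp: le_divide_eq)
  then show ?thesis by (simp add: order_def)
qed

lemma d_le: "\<epsilon> * d \<le> card V"
proof -
  obtain v where v: "v \<in> V" using card_V by fastforce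
  have "\<epsilon> * d * card {v} \<le> card (E \<inter> {v} \<times> (V - {v}))"
    using v card_V by (intro expansion) auto
  also have "\<dots> = card (E `` {v} \<inter> (V - {v}))"
    using finite_V by (simp add: card_edges_eq_sum)
  also have "\<dots> \<le> card V"
    using finite_V by (auto intro!: card_mono)
  finally show ?thesis by simp
qed

text \<open>Sparseness gives d l <= 2 n, needed for the second moment bound, and C ln d <=
  \<open>width\<close>, hence l >= C^2 ln d, which brings exp(- c^2 l / 16) below 1 / d. The lower
  bounds on \<open>C\<close> make both exponents at least ln d; the upper bounds on \<beta> keep the
  total size below \<epsilon>^2 n / 100 and the expected detours below a fraction of
  \<open>l\<close>.\<close>

lemma sparse_branch_sets:
  fixes C \<beta> :: real
  defines "c \<equiv> \<epsilon> / 4"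
  assumes C: "1 \<le> C" "8 / (c ^ 3 * hit_const c) \<le> C" "16 / c\<^sup>2 \<le> C"
    and \<beta>: "0 < \<beta>" "\<beta> \<le> \<epsilon>\<^sup>2 / (1200 * C)" "\<beta> \<le> c * detour_const c * C / 16"
    and t: "t \<le> 2 * \<beta> * order"
    and sparse: "C\<^sup>2 * (d * ln d) \<le> card V"
  shows "\<exists>F. branch_sets t F"
proof -
  let ?h = "hit_const c" and ?\<delta> = "detour_const c"
  have c: "0 < c" "c \<le> 1" using \<epsilon> by (auto simp: c_def)
  have h: "0 < ?h" and \<delta>: "0 < ?\<delta>"
    using hit_const_pos[OF c] detour_const_bounds[OF c] by auto
  have C_sq: "C \<le> C\<^sup>2" using C(1) by (simp add: power2_eq_square)
  have d: "real d > 0" using d_ge_3 by simp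
  define l where "l = nat \<lceil>C * width\<rceil>"
  have "C\<^sup>2 * (d * ln d) * ln d \<le> card V * ln d"
    using sparse ln_d(1) by (intro mult_right_mono) auto
  also have "\<dots> = width * width * d" by (rule width_sq[symmetric])
  finally have "d * (C * ln d)\<^sup>2 \<le> d * width\<^sup>2"
    by (simp add: power2_eq_square mult_ac)
  then have "(C * ln d)\<^sup>2 \<le> width\<^sup>2"
    using d by (rule mult_left_le_imp_le)
  then have width_ge: "C * ln d \<le> width"
    by (rule power2_le_imp_le) (use width_pos in simp)
  then have "C * (C * ln d) \<le> C * width"
    using C(1) by (intro mult_left_mono) auto
  then have Cw: "C\<^sup>2 * ln d \<le> C * width"
    by (simp add: power2_eq_square mult_ac)
  have "1 * 1 \<le> C\<^sup>2 * ln d"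
    using C(1) C_sq ln_d(1) by (intro mult_mono) auto
  then have "1 \<le> C * width" using Cw by linarith
  then have l: "C * width \<le> l" "l \<le> 2 * (C * width)" "1 \<le> l"
    unfolding l_def by linarith+
  have dl: "d * l \<le> 2 * card V"
  proof -
    have "(C * (d * width))\<^sup>2 = (C\<^sup>2 * (d * ln d)) * card V"
      using width_sq by (simp add: power2_eq_square mult_ac)
    also have "\<dots> \<le> real (card V) * card V"
      using sparse by (rule mult_right_mono) simp
    finally have "C * (d * width) \<le> card V"
      by (intro power2_le_imp_le[of "C * (d * width)" "real (card V)"]) (auto simp: power2_eq_square)
    moreover have "real d * l \<le> d * (2 * (C * width))"
      using l(2) by (intro mult_left_mono) auto
    ultimately have "real d * l \<le> 2 * card V" by (simp add: mult_ac)
    then show ?thesis by (simp flip: of_nat_mult)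
  qed
  have dl2: "C\<^sup>2 * (card V * ln d) \<le> d * l * l"
  proof -
    have "C\<^sup>2 * (card V * ln d) = d * ((C * width) * (C * width))"
      using width_sq by (simp add: power2_eq_square mult_ac)
    also have "\<dots> \<le> d * (real l * l)"
      using l(1) C(1) width_pos by (intro mult_left_mono mult_mono) auto
    finally show ?thesis by (simp add: mult_ac)
  qed
  have ts: "t * (3 * real l) \<le> \<epsilon>\<^sup>2 / 100 * card V"
  proof -
    have "t * (3 * real l) \<le> (2 * \<beta> * order) * (3 * (2 * (C * width)))"
      using t l(2) \<beta>(1) order_pos by (intro mult_mono) auto
    also have "\<dots> = \<beta> * (12 * C) * (order * width)"
      by (simp add: mult_ac)
    also have "\<dots> \<le> \<epsilon>\<^sup>2 / (1200 * C) * (12 * C) * (order * width)"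
      using \<beta>(2) C(1) order_pos width_pos by (intro mult_right_mono) auto
    finally show ?thesis using C(1) by (simp add: order_width)
  qed
  show ?thesis
    unfolding branch_sets_def
  proof (rule branch_sets_exist[where s = "3 * real l" and d = d and \<epsilon> = \<epsilon>
        and Good = "\<lambda>W R. ?h * d * l \<le> card (E `` W \<inter> R)"])
    fix R F
    assume R: "expander E R (\<epsilon> / 4) d" "R \<subseteq> V" "3 / 4 * card V \<le> card R"
      and F: "finite F" "card F < t" "\<And>W. W \<in> F \<Longrightarrow> ?h * d * l \<le> card (E `` W \<inter> R)"
    interpret expander E R c d using R(1) by (simp add: c_def)
    define y where "y = c\<^sup>2 / 8 * (?h * d * l / card R) * l"
    have RV: "card R \<le> card V" using finite_V R(2) by (rule card_mono)
    have Rpos: "card R > 0" using R(3) card_V by linarith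
    have y_ge: "ln d \<le> c * y"
    proof -
      have "1 \<le> c ^ 3 * ?h / 8 * C\<^sup>2"
      proof -
        have "c ^ 3 * ?h / 8 * (8 / (c ^ 3 * ?h)) \<le> c ^ 3 * ?h / 8 * C\<^sup>2"
          using C(2) C_sq c h by (intro mult_left_mono) auto
        then show ?thesis using c h by simp
      qed
      then have "1 * ln d \<le> c ^ 3 * ?h / 8 * C\<^sup>2 * ln d"
        using ln_d(1) by (intro mult_right_mono) auto
      also have "\<dots> = c ^ 3 * ?h / 8 * ((C\<^sup>2 * (card V * ln d)) / card V)"
        using card_V by simp
      also have "\<dots> \<le> c ^ 3 * ?h / 8 * ((d * l * l) / card R)"
        using dl2 RV Rpos c h by (intro mult_left_mono frac_le) auto
      also have "\<dots> = c * y"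
        by (simp add: y_def power2_eq_square power3_eq_cube)
      finally show ?thesis by simp
    qed
    have "c * y \<le> 1 * y"
      using c h by (intro mult_right_mono) (auto simp: y_def)
    then have e1: "exp (- y) \<le> 1 / d"
    proof -
      assume "c * y \<le> 1 * y"
      then have "exp (- y) \<le> exp (- ln d)" using y_ge by simp
      also have "\<dots> = 1 / d" using d by (simp add: exp_minus field_simps)
      finally show ?thesis .
    qed
    have e2: "exp (- (c\<^sup>2 * l / 16)) \<le> 1 / d"
    proof -
      have "c\<^sup>2 / 16 * (16 / c\<^sup>2) \<le> c\<^sup>2 / 16 * C\<^sup>2"
        using C(3) C_sq by (intro mult_left_mono) auto
      then have "1 * ln d \<le> c\<^sup>2 / 16 * C\<^sup>2 * ln d"
        using c ln_d(1) by (intro mult_right_mono) auto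
      also have "\<dots> = c\<^sup>2 / 16 * (C\<^sup>2 * ln d)" by simp
      also have "\<dots> \<le> c\<^sup>2 / 16 * l"
        using Cw l(1) by (intro mult_left_mono) auto
      finally have "exp (- (c\<^sup>2 * l / 16)) \<le> exp (- ln d)" by simp
      also have "\<dots> = 1 / d" using d by (simp add: exp_minus field_simps)
      finally show ?thesis .
    qed
    \<comment> \<open>The expected distance to one earlier set is at most 4 / (c d). Times 2 \<beta>
      \<open>order\<close> this is at most 8 \<beta> \<open>width\<close> / c, because order <=
      order ln d = d width.\<close>
    have cost: "card F * (2 * exp (- y) + 2 / c * exp (- (c\<^sup>2 * l / 16))) \<le> ?\<delta> * l / 2"
    proof -
      have "2 * exp (- y) + 2 / c * exp (- (c\<^sup>2 * l / 16)) \<le> 2 * (1 / d) + 2 / c * (1 / d)"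
        using e1 e2 c by (intro add_mono mult_left_mono) auto
      also have "\<dots> \<le> 2 / c * (1 / d) + 2 / c * (1 / d)"
        using c d by (intro add_mono mult_right_mono) (auto simp: field_simps)
      finally have "2 * exp (- y) + 2 / c * exp (- (c\<^sup>2 * l / 16)) \<le> 4 / (c * d)"
        by simp
      then have "card F * (2 * exp (- y) + 2 / c * exp (- (c\<^sup>2 * l / 16))) \<le> (2 * \<beta> * order) * (4 / (c * d))"
        using F(2) t c d \<beta>(1) order_pos by (intro mult_mono) auto
      also have "\<dots> = 8 * \<beta> / c * (order * 1 / d)" by simp
      also have "\<dots> \<le> 8 * \<beta> / c * (order * ln d / d)"
        using ln_d(1) order_pos \<beta>(1) c by (intro mult_left_mono divide_right_mono) auto
      also have "\<dots> = 8 * \<beta> / c * width"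
        using d by (simp add: order_eq)
      also have "\<dots> \<le> 8 * (c * ?\<delta> * C / 16) / c * width"
        using \<beta>(3) c width_pos by (intro mult_right_mono divide_right_mono mult_left_mono) auto
      also have "\<dots> = ?\<delta> * (C * width) / 2"
        using c by simp
      also have "\<dots> \<le> ?\<delta> * l / 2"
        using l(1) \<delta> by (intro divide_right_mono mult_left_mono) auto
      finally show ?thesis .
    qed
    have "d * l \<le> 4 * card R"
      using dl R(3) by linarith
    then have dl_R: "real d * l \<le> real (4 * card R)"
      by (simp flip: of_nat_mult)
    have "1 \<le> c * y" using y_ge ln_d(1) by linarith
    from sparse_extension[OF l(3) dl_R F(1,3) this[unfolded y_def] cost[unfolded y_def]]
    obtain W where W: "W \<subseteq> R" "W \<noteq> {}" "conn E W" "card W \<le> 3 * l" "\<forall>B\<in>F. E `` B \<inter> W \<noteq> {}"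
      "\<forall>R'\<subseteq>R. ?h * d * l \<le> card (E `` W \<inter> R') \<or> card (E \<inter> W \<times> R') \<le> c * d * card W"
      by blast
    moreover have "real (card W) \<le> 3 * real l" using W(4) by simp
    ultimately show "\<exists>W\<subseteq>R. W \<noteq> {} \<and> conn E W \<and> card W \<le> 3 * real l \<and> (\<forall>B\<in>F. E `` B \<inter> W \<noteq> {})
        \<and> (\<forall>R'\<subseteq>R. ?h * d * l \<le> card (E `` W \<inter> R') \<or> card (E \<inter> W \<times> R') \<le> \<epsilon> / 4 * d * card W)"
      unfolding c_def by blast
  qed (use finite_V card_V sym_E degree_le expansion \<epsilon> d ts in auto)
qed

text \<open>Density gives \<open>order\<close> <= C d, so failure probability 1 / d per set suffices
  for a union bound, and n <= C d \<open>width\<close>, so the backbone has O(\<open>width\<close>)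
  vertices. Goodness with the fixed bound 2 n exp(- x) passes to all subsets of \<open>R\<close>, so
  the first alternative of the dichotomy always holds.\<close>

lemma dense_branch_sets:
  fixes C C' \<beta> :: real
  defines "c \<equiv> \<epsilon> / 4"
  assumes C: "1 \<le> C" and C': "1 \<le> C'" "1 / \<epsilon> \<le> C'" "4 * C / c \<le> C'" "2 / c \<le> C'"
    and \<beta>: "0 < \<beta>" "\<beta> \<le> 1 / (8 * C)" "\<beta> \<le> \<epsilon>\<^sup>2 / (200 * (3 * C / c + 18 * C'))"
    and t: "t \<le> 2 * \<beta> * order"
    and dense: "card V < C\<^sup>2 * (d * ln d)"
  shows "\<exists>F. branch_sets t F"
proof -
  have c: "0 < c" "c \<le> 1" using \<epsilon> by (auto simp: c_def)
  have d: "real d > 0" using d_ge_3 by simp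
  have n: "real (card V) > 0" using card_V by simp
  define q where "q = nat \<lceil>C' * width\<rceil>"
  \<comment> \<open>Keeps C' \<open>width\<close> at least 1, so that rounding it up to
    \<open>q\<close> at most doubles it.\<close>
  have width_sq_ge: "\<epsilon> \<le> width\<^sup>2"
  proof -
    have "\<epsilon> * d * 1 \<le> card V * ln d"
      using d_le ln_d(1) n by (intro mult_mono) auto
    then have "\<epsilon> * d \<le> width\<^sup>2 * d"
      using width_sq by (simp add: power2_eq_square)
    then show ?thesis using d by (rule mult_right_le_imp_le)
  qed
  have "\<epsilon>\<^sup>2 \<le> \<epsilon>" using \<epsilon> by (simp add: power2_eq_square)
  then have "\<epsilon> \<le> width"
    using width_sq_ge width_pos power2_le_imp_le[of \<epsilon> width] by simp
  then have "1 / \<epsilon> * \<epsilon> \<le> C' * width"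
    using C' \<epsilon> by (intro mult_mono) auto
  then have "1 \<le> C' * width" using \<epsilon> by simp
  then have q: "C' * width \<le> q" "q \<le> 2 * (C' * width)" "1 \<le> q"
    unfolding q_def by linarith+
  have n_le: "card V \<le> C * d * width"
  proof -
    have "card V * real (card V) \<le> (C\<^sup>2 * (d * ln d)) * card V"
      using dense by (intro mult_right_mono) auto
    also have "\<dots> = (C * d * width) * (C * d * width)"
      using width_sq by (simp add: power2_eq_square mult_ac)
    finally show ?thesis
      using C d width_pos by (intro power2_le_imp_le[of "real (card V)" "C * d * width"]) (auto simp: power2_eq_square)
  qed
  have order_le: "order \<le> C * d"
  proof -
    have "order * width \<le> (C * d) * width"
      using n_le by (simp add: order_width)
    then show ?thesis using width_pos by simp
  qed
  define x where "x = c * d * q / card V"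
  have x_ge: "4 \<le> x"
  proof -
    have "4 * card V \<le> 4 * (C * d * width)" using n_le by simp
    also have "\<dots> = c * d * (4 * C / c * width)" using c by simp
    also have "\<dots> \<le> c * d * (C' * width)"
      using C'(3) c width_pos by (intro mult_left_mono mult_right_mono) auto
    also have "\<dots> \<le> c * d * q"
      using q(1) c by (intro mult_left_mono) auto
    finally show ?thesis using n by (simp add: x_def pos_le_divide_eq)
  qed
  \<comment> \<open>As |R| >= 3 n / 4, the bound 2 n exp(- x) is at most (8/3) exp(- x) |R|; half of
    the exponent is spent on absorbing 8/3.\<close>
  define \<mu> where "\<mu> = exp (- x / 2)"
  have \<mu>: "8 / 3 * exp (- x) \<le> \<mu>"
  proof -
    have "8 / 3 \<le> exp (x / 2)"
      using x_ge exp_ge_add_one_self[of "x / 2"] by linarith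
    then have "8 / 3 * exp (- x) \<le> exp (x / 2) * exp (- x)"
      by (rule mult_right_mono) simp
    then show ?thesis by (simp add: \<mu>_def mult_exp_exp)
  qed
  have \<mu>_q: "\<mu> ^ q \<le> 1 / d"
  proof -
    have "2 \<le> c * C' * C'"
    proof -
      have "c * (2 / c) * 1 \<le> c * C' * C'"
        using C' c by (intro mult_mono) auto
      then show ?thesis using c by simp
    qed
    then have "2 * (card V * ln d) \<le> c * C' * C' * (card V * ln d)"
      using ln_d(1) by (intro mult_right_mono) auto
    also have "\<dots> = c * d * ((C' * width) * (C' * width))"
      unfolding width_sq[symmetric] by (simp add: mult_ac)
    also have "\<dots> \<le> c * d * (real q * q)"
      using q(1) C' c width_pos by (intro mult_left_mono mult_mono) auto
    finally have "ln d \<le> q * (x / 2)"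
      using n by (simp add: x_def field_simps)
    have "\<mu> ^ q = exp (q * (- x / 2))"
      by (simp only: \<mu>_def exp_of_nat_mult)
    also have "\<dots> \<le> exp (- ln d)"
      using \<open>ln d \<le> q * (x / 2)\<close> by simp
    also have "\<dots> = 1 / d" using d by (simp add: exp_minus field_simps)
    finally show ?thesis .
  qed
  define s where "s = (3 * C / c + 18 * C') * width"
  have S_pos: "3 * C / c + 18 * C' > 0" using C C' c by (intro add_pos_pos) auto
  have ts: "t * s \<le> \<epsilon>\<^sup>2 / 100 * card V"
  proof -
    have "t * s \<le> 2 * \<beta> * order * s"
      using t S_pos width_pos by (intro mult_right_mono) (auto simp: s_def)
    also have "\<dots> = \<beta> * (2 * (3 * C / c + 18 * C')) * (order * width)"
      by (simp add: s_def mult_ac)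
    also have "\<dots> \<le> \<epsilon>\<^sup>2 / (200 * (3 * C / c + 18 * C')) * (2 * (3 * C / c + 18 * C')) * (order * width)"
      using \<beta>(3) S_pos order_pos width_pos by (intro mult_right_mono) auto
    also have "\<dots> = \<epsilon>\<^sup>2 / 100 * card V"
    proof -
      have "e / (200 * S) * (2 * S) * w = e / 100 * w" if "S > 0" for e S w :: real
        using that by (simp add: field_simps)
      from this[OF S_pos] show ?thesis by (simp only: order_width)
    qed
    finally show ?thesis .
  qed
  have s_pos: "0 \<le> s" using S_pos width_pos by (simp add: s_def)
  show ?thesis
    unfolding branch_sets_def
  proof (rule branch_sets_exist[where s = s and d = d and \<epsilon> = \<epsilon>
        and Good = "\<lambda>W R. card (R - E `` W) \<le> 2 * card V * exp (- x)"])
    fix R F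
    assume R: "expander E R (\<epsilon> / 4) d" "R \<subseteq> V" "3 / 4 * card V \<le> card R"
      and F: "finite F" "card F < t" "\<And>W. W \<in> F \<Longrightarrow> card (R - E `` W) \<le> 2 * card V * exp (- x)"
    interpret expander E R c d using R(1) by (simp add: c_def)
    have RV: "card R \<le> card V" using finite_V R(2) by (rule card_mono)
    have Rpos: "card R > 0" using R(3) card_V by linarith
    have miss: "card (R - E `` W) \<le> \<mu> * card R" if "W \<in> F" for W
    proof -
      have "card (R - E `` W) \<le> 8 / 3 * exp (- x) * (3 / 4 * card V)"
        using F(3)[OF that] by simp
      also have "\<dots> \<le> \<mu> * card R"
        using \<mu> R(3) by (intro mult_mono) (auto simp: \<mu>_def)
      finally show ?thesis .
    qed
    have "card F * \<mu> ^ q < 1 / 2"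
    proof -
      have "card F * \<mu> ^ q \<le> (2 * \<beta> * (C * d)) * (1 / d)"
      proof (intro mult_mono \<mu>_q)
        have "2 * \<beta> * order \<le> 2 * \<beta> * (C * d)"
          using \<beta>(1) order_le by (intro mult_left_mono) auto
        then show "real (card F) \<le> 2 * \<beta> * (C * d)" using F(2) t by linarith
      qed (use \<beta>(1) C in \<open>auto simp: \<mu>_def\<close>)
      also have "\<dots> = 2 * \<beta> * C" using d by simp
      also have "\<dots> \<le> 2 * (1 / (8 * C)) * C"
        using \<beta>(2) C by (intro mult_right_mono mult_left_mono) auto
      also have "\<dots> < 1 / 2" using C by simp
      finally show ?thesis .
    qed
    from dense_extension[OF F(1) miss _ this q(3)]
    obtain W where W: "W \<subseteq> R" "W \<noteq> {}" "conn E W" "real (card W) \<le> 3 * card R / (c * d) + 9 * q"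
      "\<forall>B\<in>F. E `` B \<inter> W \<noteq> {}" "card (R - E `` W) \<le> 2 * card R * exp (- (c * d * q / card R))"
      by (auto simp: \<mu>_def)
    have "3 * card R / (c * d) \<le> 3 * (C * d * width) / (c * d)"
      using n_le RV c d by (intro divide_right_mono) auto
    also have "\<dots> = 3 * C / c * width" using d by simp
    finally have "card W \<le> s"
      using W(4) q(2) by (simp add: s_def algebra_simps)
    moreover have "card (R' - E `` W) \<le> 2 * card V * exp (- x)" if "R' \<subseteq> R" for R'
    proof -
      have "card (R' - E `` W) \<le> card (R - E `` W)"
        using that finite_R by (intro card_mono) auto
      also have "real (card (R - E `` W)) \<le> 2 * card R * exp (- (c * d * q / card R))"
        by (rule W(6))
      also have "\<dots> \<le> 2 * card V * exp (- x)"
        using RV Rpos c by (intro mult_mono) (auto simp: x_def intro!: divide_left_mono)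
      finally show ?thesis by simp
    qed
    ultimately show "\<exists>W\<subseteq>R. W \<noteq> {} \<and> conn E W \<and> card W \<le> s \<and> (\<forall>B\<in>F. E `` B \<inter> W \<noteq> {})
        \<and> (\<forall>R'\<subseteq>R. card (R' - E `` W) \<le> 2 * card V * exp (- x) \<or> card (E \<inter> W \<times> R') \<le> \<epsilon> / 4 * d * card W)"
      using W by blast
  qed (use finite_V card_V sym_E degree_le expansion \<epsilon> d ts s_pos in auto)
qed

end

lemma branch_sets_constant:
  fixes \<epsilon> :: real
  assumes \<epsilon>: "0 < \<epsilon>" "\<epsilon> \<le> 1"
  obtains \<beta> :: real and n\<^sub>0 :: nat where "0 < \<beta>"
    "\<And>(V :: 'a set) E d. cheeger_graph V E \<epsilon> d \<Longrightarrow> n\<^sub>0 \<le> card V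
      \<Longrightarrow> \<exists>t F. \<beta> * sqrt (card V * d / ln d) \<le> t \<and> cheeger_graph.branch_sets V E t F"
proof -
  define c where "c = \<epsilon> / 4"
  have c: "0 < c" "c \<le> 1" using \<epsilon> by (auto simp: c_def)
  have h: "0 < hit_const c" and \<delta>: "0 < detour_const c"
    using hit_const_pos[OF c] detour_const_bounds[OF c] by auto
  define C where "C = 1 + 8 / (c ^ 3 * hit_const c) + 16 / c\<^sup>2"
  have C: "1 \<le> C" "8 / (c ^ 3 * hit_const c) \<le> C" "16 / c\<^sup>2 \<le> C"
    using c h by (auto simp: C_def add_increasing)
  define C' where "C' = 1 + 1 / \<epsilon> + 4 * C / c + 2 / c"
  have C': "1 \<le> C'" "1 / \<epsilon> \<le> C'" "4 * C / c \<le> C'" "2 / c \<le> C'"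
    using c C(1) \<epsilon> by (auto simp: C'_def add_increasing)
  define \<beta> where "\<beta> = Min {\<epsilon>\<^sup>2 / (1200 * C), c * detour_const c * C / 16, 1 / (8 * C),
    \<epsilon>\<^sup>2 / (200 * (3 * C / c + 18 * C'))}"
  have S_pos: "3 * C / c + 18 * C' > 0" using C C' c by (intro add_pos_pos) auto
  have "0 < \<beta>"
    using C(1) c \<delta> \<epsilon> S_pos unfolding \<beta>_def by auto
  moreover have "\<beta> \<le> \<epsilon>\<^sup>2 / (1200 * C)" "\<beta> \<le> c * detour_const c * C / 16" "\<beta> \<le> 1 / (8 * C)"
    "\<beta> \<le> \<epsilon>\<^sup>2 / (200 * (3 * C / c + 18 * C'))"
    unfolding \<beta>_def by (rule Min_le, simp, blast)+
  ultimately have \<beta>: "0 < \<beta>" "\<beta> \<le> \<epsilon>\<^sup>2 / (1200 * C)" "\<beta> \<le> c * detour_const c * C / 16"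
    "\<beta> \<le> 1 / (8 * C)" "\<beta> \<le> \<epsilon>\<^sup>2 / (200 * (3 * C / c + 18 * C'))"
    by simp_all
  \<comment> \<open>The threshold (1 / \<beta>)^2 ensures \<beta> \<open>order\<close> >= 1, so
    rounding it up to \<open>t\<close> at most doubles it.\<close>
  have "\<exists>t F. \<beta> * sqrt (card V * d / ln d) \<le> t \<and> cheeger_graph.branch_sets V E t F"
    if G: "cheeger_graph V E \<epsilon> d" and n: "nat \<lceil>(1 / \<beta>)\<^sup>2\<rceil> \<le> card V" for V :: "'a set" and E d
  proof -
    interpret cheeger_graph V E \<epsilon> d by (rule G)
    define t where "t = nat \<lceil>\<beta> * order\<rceil>"
    have "(1 / \<beta>)\<^sup>2 \<le> card V" using n by linarith
    then have "1 / \<beta> \<le> sqrt (card V)" by (rule real_le_rsqrt)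
    then have "1 / \<beta> \<le> order" using order_ge by linarith
    then have "1 \<le> \<beta> * order" using \<beta>(1) by (simp add: pos_divide_le_eq mult.commute)
    then have t: "\<beta> * order \<le> t" "t \<le> 2 * \<beta> * order"
      unfolding t_def by linarith+
    have "\<exists>F. branch_sets t F"
    proof (cases "C\<^sup>2 * (d * ln d) \<le> card V")
      case True
      then show ?thesis
        using sparse_branch_sets[of C \<beta> t] C \<beta> t by (simp add: c_def)
    next
      case False
      then show ?thesis
        using dense_branch_sets[of C C' \<beta> t] C(1) C' \<beta> t by (simp add: c_def)
    qed
    then show ?thesis using t(1) by (auto simp: order_def)
  qed
  with \<beta>(1) show ?thesis by (rule that)
qed

subsection \<open>Clique minors\<close>

text \<open>Passes from the plain reflexive-transitive closure to \<open>rtrancl_on\<close>, whose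
  paths stay in the vertex set.\<close>

lemma connected_induce_subgraph:
  assumes "W \<noteq> {}" "conn (parcs G) W"
  shows "connected (with_proj G \<restriction> W)"
proof -
  let ?H = "with_proj G \<restriction> W"
  have sub: "parcs G \<inter> W \<times> W \<subseteq> (arcs_ends ?H)\<^sup>s"
    by (auto simp: induce_subgraph_def arcs_ends_conv symcl_def)
  have "(u, v) \<in> rtrancl_on (verts ?H) ((arcs_ends ?H)\<^sup>s)" if "u \<in> W" "v \<in> W" for u v
  proof -
    have "(u, v) \<in> (parcs G \<inter> W \<times> W)\<^sup>*"
      using assms(2) that by (simp add: conn_def)
    then have "(u, v) \<in> rtrancl_on W (parcs G \<inter> W \<times> W)"
      using that by (intro rtrancl_consistent_rtrancl_on) auto
    then show ?thesis
      using sub by (auto intro: rtrancl_on_mono)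
  qed
  then show ?thesis
    using assms(1) by (simp add: connected_conv)
qed

lemma cheeger_graphI:
  assumes G: "pair_graph G" and card: "3 \<le> card (pverts G)" and d: "3 \<le> d"
    and deg: "\<forall>v\<in>pverts G. out_degree (with_proj G) v \<le> d"
    and h: "\<epsilon> * real d \<le> cheeger G" and \<epsilon>: "0 < \<epsilon>" "\<epsilon> \<le> 1"
  shows "cheeger_graph (pverts G) (parcs G) \<epsilon> d"
proof
  interpret pair_graph G by (rule G)
  show fin: "finite (pverts G)" by simp
  show "sym (parcs G)" using arcs_symmetric by (auto intro: symI)
  show "real (card (parcs G `` {v} \<inter> pverts G)) \<le> d" if "v \<in> pverts G" for v
  proof -
    have "parcs G `` {v} \<inter> pverts G \<subseteq> snd ` out_arcs (with_proj G) v"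
      by (force simp: out_arcs_def)
    then have "card (parcs G `` {v} \<inter> pverts G) \<le> card (out_arcs (with_proj G) v)"
      by (intro surj_card_le[where f = snd]) auto
    also have "\<dots> \<le> d" using deg that by (simp add: out_degree_def)
    finally show ?thesis by simp
  qed
  show "\<epsilon> * d * card S \<le> card (parcs G \<inter> S \<times> (pverts G - S))"
    if S: "S \<subseteq> pverts G" "2 * card S \<le> card (pverts G)" for S
  proof (cases "S = {}")
    case False
    have "real (card S) \<le> real (card (pverts G)) / 2"
      using S(2) by linarith
    then have "cheeger G \<le> real (edges_between G S (pverts G - S)) / real (card S)"
      unfolding cheeger_def using S(1) False by (intro Min_le cheeger_set_finite fin) blast
    then have "\<epsilon> * d \<le> real (edges_between G S (pverts G - S)) / real (card S)"
      using h by linarith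
    moreover have "card S > 0"
      using False S(1) fin by (auto simp: card_gt_0_iff intro: finite_subset)
    moreover have "edges_between G S (pverts G - S) = card (parcs G \<inter> S \<times> (pverts G - S))"
      unfolding edges_between_def by (rule arg_cong[where f = card]) auto
    ultimately show ?thesis by (simp add: pos_le_divide_eq)
  qed simp
qed (use assms in auto)

lemma branch_sets_imp_minor:
  assumes "cheeger_graph (pverts G) (parcs G) \<epsilon> d"
    and "cheeger_graph.branch_sets (pverts G) (parcs G) t F"
  shows "is_minor (complete_graph t) G"
proof -
  interpret cheeger_graph "pverts G" "parcs G" \<epsilon> d by (rule assms(1))
  have F: "finite F" "card F = t" "disjoint F" "\<And>W. W \<in> F \<Longrightarrow> W \<noteq> {} \<and> W \<subseteq> pverts G \<and> conn (parcs G) W"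
    "\<And>A B. A \<in> F \<Longrightarrow> B \<in> F \<Longrightarrow> A \<noteq> B \<Longrightarrow> parcs G `` A \<inter> B \<noteq> {}"
    using assms(2) by (auto simp: branch_sets_def)
  obtain f where f: "bij_betw f {..<t} F"
    using ex_bij_betw_nat_finite[OF F(1)] F(2) by (auto simp: atLeast0LessThan)
  have fF: "f i \<in> F" if "i < t" for i
    using f that by (auto simp: bij_betw_def)
  have neq: "f i \<noteq> f j" if "i < t" "j < t" "i \<noteq> j" for i j
    using f that by (auto simp: bij_betw_def inj_on_def)
  show ?thesis
    unfolding is_minor_def complete_graph_def
  proof (intro exI[of _ f] conjI ballI)
    show "disjoint_family_on f (pverts \<lparr>pverts = {..<t}, parcs = {(i, j). i < t \<and> j < t \<and> i \<noteq> j}\<rparr>)"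
      using F(3) fF neq by (auto simp: disjoint_family_on_def disjoint_def)
  next
    fix x assume "x \<in> pverts \<lparr>pverts = {..<t}, parcs = {(i, j). i < t \<and> j < t \<and> i \<noteq> j}\<rparr>"
    then have "f x \<in> F" using fF by simp
    then show "f x \<noteq> {}" "f x \<subseteq> pverts G" "connected (with_proj G \<restriction> f x)"
      using F(4) connected_induce_subgraph[of "f x" G] by auto
  next
    fix p assume "p \<in> parcs \<lparr>pverts = {..<t}, parcs = {(i, j). i < t \<and> j < t \<and> i \<noteq> j}\<rparr>"
    then obtain i j where ij: "p = (i, j)" "i < t" "j < t" "i \<noteq> j" by auto
    then have "parcs G `` f i \<inter> f j \<noteq> {}"
      using F(5)[OF fF[OF ij(2)] fF[OF ij(3)] neq[OF ij(2-4)]] by simp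
    then show "case p of (x, y) \<Rightarrow> \<exists>u\<in>f x. \<exists>v\<in>f y. (u, v) \<in> parcs G"
      using ij(1) by auto
  qed
qed

theorem theorem1p4:
  fixes \<epsilon> :: real
  assumes "\<epsilon> > 0"
  shows "\<exists>\<beta>::real. \<beta> > 0 \<and> (\<exists>n\<^sub>0::nat. \<forall>(d::nat) (n::nat) (G::'a pair_pre_digraph).
    d \<ge> 3 \<longrightarrow> pair_graph G \<longrightarrow> card (pverts G) = n \<longrightarrow> n \<ge> n\<^sub>0 \<longrightarrow>
    (\<forall>v\<in>pverts G. out_degree (with_proj G) v \<le> d) \<longrightarrow>
    cheeger G \<ge> \<epsilon> * real d \<longrightarrow>
    real (ccl G) \<ge> \<beta> * sqrt (real n * real d / ln (real d)))"
proof -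
  \<comment> \<open>Expansion only weakens when \<epsilon> decreases; \<epsilon> <= 1 serves to
    bound \<epsilon>^2 by \<epsilon> and to keep \<open>c\<close> at most 1.\<close>
  define \<epsilon>' where "\<epsilon>' = min \<epsilon> 1"
  have \<epsilon>': "0 < \<epsilon>'" "\<epsilon>' \<le> 1" using assms by (auto simp: \<epsilon>'_def)
  obtain \<beta> :: real and n\<^sub>0 :: nat where \<beta>: "0 < \<beta>"
    "\<And>(V :: 'a set) E d. cheeger_graph V E \<epsilon>' d \<Longrightarrow> n\<^sub>0 \<le> card V
      \<Longrightarrow> \<exists>t F. \<beta> * sqrt (card V * d / ln d) \<le> t \<and> cheeger_graph.branch_sets V E t F"
    using branch_sets_constant[OF \<epsilon>'] by blast
  show ?thesis
  \<comment> \<open>Three vertices ensure that every \<open>R\<close> with |R| >= 3 n / 4 has at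
    least two.\<close>
  proof (intro exI[of _ \<beta>] conjI exI[of _ "max n\<^sub>0 3"] allI impI)
    fix d n :: nat and G :: "'a pair_pre_digraph"
    assume d: "3 \<le> d" and G: "pair_graph G" and n: "card (pverts G) = n" "max n\<^sub>0 3 \<le> n"
      and deg: "\<forall>v\<in>pverts G. out_degree (with_proj G) v \<le> d"
      and h: "\<epsilon> * real d \<le> cheeger G"
    have "\<epsilon>' * real d \<le> \<epsilon> * real d"
      by (intro mult_right_mono) (auto simp: \<epsilon>'_def)
    then have "\<epsilon>' * real d \<le> cheeger G" using h by linarith
    then have cg: "cheeger_graph (pverts G) (parcs G) \<epsilon>' d"
      using G n d deg \<epsilon>' by (intro cheeger_graphI) auto
    then obtain t F where t: "\<beta> * sqrt (card (pverts G) * d / ln d) \<le> t"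
      "cheeger_graph.branch_sets (pverts G) (parcs G) t F"
      using \<beta>(2)[OF cg] n by auto
    have "t \<le> ccl G"
      using branch_sets_imp_minor[OF cg t(2)] pair_graph.axioms(1)[OF G]
        pair_fin_digraph.pair_finite_verts[OF pair_digraph.axioms(1)]
      by (intro is_minor_complete_graph_ccl) auto
    with t(1) show "\<beta> * sqrt (real n * real d / ln (real d)) \<le> real (ccl G)"
      using n(1) by simp
  qed (rule \<beta>(1))
qed

end
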